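(* Let $E$ be an arbitrary directed graph and $K$ a field. Then $I(P_{ec})$ is a purely infinite ideal of $L_K(E)$.
   Context: A directed graph $E=(E^0,E^1,s,r)$ consists of arbitrary sets $E^0$ (vertices), $E^1$ (edges) and maps $s,r:E^1\to E^0$ (source, range). A vertex $v$ is a sink if $s^{-1}(v)=\emptyset$, an infinite emitter if $s^{-1}(v)$ is infinite, and regular otherwise. A path is a vertex (length $0$) or a finite sequence of edges $e_1\cdots e_n$ with $r(e_i)=s(e_{i+1})$. A cycle $c$ is a path $e_1\cdots e_n$, $n>0$, with $r(e_n)=s(e_1)$ and $s(e_i)\ne s(e_j)$ for $i\ne j$; $c^0$ is its set of vertices. An exit for it is an edge $e$ with $s(e)=s(e_i)$, $e\neq e_i$ for some $i$. A cycle $c$ is extreme if it has exits and for every path $\lambda$ starting at a vertex of $c^0$ there is a path $\mu$ with $s(\mu)=r(\lambda)$ and $r(\mu)\in c^0$. $P_{ec}$ is the set of vertices belonging to extreme cycles. The Leavitt path algebra $L_K(E)$ is the $K$-algebra generated by $\{v: v\in E^0\}\cup\{e,e^*: e\in E^1\}$ subject to: $vw=\delta_{v,w}v$ for $v,w\in E^0$; $s(e)e=e\,r(e)=e$ and $r(e)e^*=e^*s(e)=e^*$ for $e\in E^1$; $e^*e'=\delta_{e,e'}r(e)$ for $e,e'\in E^1$; $v=\sum_{s(e)=v}ee^*$ for every regular vertex $v$. $I(X)$ is the two-sided ideal generated by $X$. A ring $R$ (not necessarily unital) is purely infinite if (1) no quotient of $R$ is a division ring, and (2) whenever $a\in R$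 and $b\in RaR$, there are $x,y\in R$ with $b=xay$. An ideal is purely infinite if it is so as a ring. *)

theory Defs
  imports "HOL-Library.Multiset" "HOL-Algebra.QuotRing" "HOL-Library.Poly_Mapping" "Graph_Theory.Arc_Walk"
begin

section \<open>Graphs and extreme cycles\<close>

text \<open>
  A directed graph is a \<^locale>\<open>wf_digraph\<close>: \<^const>\<open>verts\<close> and \<^const>\<open>arcs\<close> are arbitrary (possibly
  infinite or empty) sets, loops and parallel edges are allowed, source is \<^const>\<open>tail\<close> and range is
  \<^const>\<open>head\<close>. A path from \<open>u\<close> to \<open>v\<close> is an edge list \<open>p\<close> with \<open>awalk u p v\<close>; the path of length 0
  at a vertex \<open>v\<close> is \<open>awalk v [] v\<close>.
\<close>

context pre_digraph
begin

text \<open>Regular: neither a sink nor an infinite emitter.\<close>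

definition regular_vertex :: "'a \<Rightarrow> bool" where
  "regular_vertex v \<longleftrightarrow> v \<in> verts G \<and> out_arcs G v \<noteq> {} \<and> finite (out_arcs G v)"

text \<open>
  \<^const>\<open>cycle\<close> asks the ranges of the edges of a closed path to be distinct; on a
  closed path these are the sources, cyclically shifted.
\<close>

lemma cycle_iff_distinct_sources:
  "cycle p \<longleftrightarrow> p \<noteq> [] \<and> (\<exists>u. awalk u p u) \<and> distinct (map (tail G) p)"
proof -
  have heads: "cas u p v \<Longrightarrow> tl (awalk_verts u p) = map (head G) p" for u p v
  proof (induction p arbitrary: u)
    case (Cons e es)
    then show ?case by (cases es) auto
  qed simp
  have shift: "cas u p v \<Longrightarrow> map (tail G) p @ [v] = u # map (head G) p" for u p v
    by (induction p arbitrary: u) auto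
  have "distinct (tl (awalk_verts u p)) \<longleftrightarrow> distinct (map (tail G) p)" if "awalk u p u" for u
  proof -
    have c: "cas u p u" using that by (simp add: awalk_def)
    have "mset (map (tail G) p) = mset (map (head G) p)"
      using arg_cong[OF shift[OF c], of mset] by simp
    then show ?thesis
      unfolding heads[OF c] by (metis mset_eq_imp_distinct_iff)
  qed
  then show ?thesis by (auto simp: cycle_def)
qed

abbreviation cycle_verts :: "'b list \<Rightarrow> 'a set" where
  "cycle_verts c \<equiv> tail G ` set c"

definition is_exit :: "'b \<Rightarrow> 'b list \<Rightarrow> bool" where
  "is_exit e c \<longleftrightarrow> e \<in> arcs G \<and> (\<exists>f\<in>set c. tail G e = tail G f \<and> e \<noteq> f)"

definition extreme_cycle :: "'b list \<Rightarrow> bool" where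
  "extreme_cycle c \<longleftrightarrow> cycle c \<and> (\<exists>e. is_exit e c) \<and>
     (\<forall>u\<in>cycle_verts c. \<forall>p v. awalk u p v \<longrightarrow> (\<exists>q. \<exists>w\<in>cycle_verts c. awalk v q w))"

definition P_ec :: "'a set" where
  "P_ec = {v. \<exists>c. extreme_cycle c \<and> v \<in> cycle_verts c}"

end

section \<open>Rings without unit\<close>

text \<open>
  Rings that need not have a unit are represented by the \<^typ>\<open>'a ring\<close> records, whose \<^const>\<open>one\<close>
  field is simply ignored (it need not even lie in the carrier).
\<close>

locale nonunital_ring = abelian_group R for R (structure) +
  assumes m_closed: "\<lbrakk>x \<in> carrier R; y \<in> carrier R\<rbrakk> \<Longrightarrow> x \<otimes> y \<in> carrier R"
    and m_assoc: "\<lbrakk>x \<in> carrier R; y \<in> carrier R; z \<in> carrier R\<rbrakk>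
      \<Longrightarrow> (x \<otimes> y) \<otimes> z = x \<otimes> (y \<otimes> z)"
    and l_distr: "\<lbrakk>x \<in> carrier R; y \<in> carrier R; z \<in> carrier R\<rbrakk>
      \<Longrightarrow> (x \<oplus> y) \<otimes> z = x \<otimes> z \<oplus> y \<otimes> z"
    and r_distr: "\<lbrakk>x \<in> carrier R; y \<in> carrier R; z \<in> carrier R\<rbrakk>
      \<Longrightarrow> z \<otimes> (x \<oplus> y) = z \<otimes> x \<oplus> z \<otimes> y"

locale nonunital_ideal = additive_subgroup I R + nonunital_ring R for I and R (structure) +
  assumes I_l_closed: "\<lbrakk>a \<in> I; x \<in> carrier R\<rbrakk> \<Longrightarrow> x \<otimes> a \<in> I"
    and I_r_closed: "\<lbrakk>a \<in> I; x \<in> carrier R\<rbrakk> \<Longrightarrow> a \<otimes> x \<in> I"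

definition nonunital_genideal :: "('a, 'm) ring_scheme \<Rightarrow> 'a set \<Rightarrow> 'a set" where
  "nonunital_genideal R X = \<Inter>{I. nonunital_ideal I R \<and> X \<subseteq> I}"

text \<open>
  Here the unit is part of what has to be found. A division ring is nontrivial, since
  \<open>\<one> \<in> Units\<close> while \<open>\<zero>\<close> is excluded.
\<close>

definition is_division_ring :: "('a, 'm) ring_scheme \<Rightarrow> bool" where
  "is_division_ring R \<longleftrightarrow> (\<exists>e\<in>carrier R. ring (R\<lparr>one := e\<rparr>) \<and>
     Units (R\<lparr>one := e\<rparr>) = carrier R - {\<zero>\<^bsub>R\<^esub>})"

text \<open>The set \<open>RaR\<close> of all finite sums of products \<open>xay\<close>.\<close>

definition two_sided_multiples :: "('a, 'm) ring_scheme \<Rightarrow> 'a \<Rightarrow> 'a set" where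
  "two_sided_multiples R a =
     {(\<Oplus>\<^bsub>R\<^esub>i\<in>{..<n}. x i \<otimes>\<^bsub>R\<^esub> a \<otimes>\<^bsub>R\<^esub> y i) |(n::nat) x y.
        x \<in> {..<n} \<rightarrow> carrier R \<and> y \<in> {..<n} \<rightarrow> carrier R}"

locale purely_infinite_ring = nonunital_ring R for R (structure) +
  assumes no_division_quotient: "nonunital_ideal I R \<Longrightarrow> \<not> is_division_ring (R Quot I)"
    and factor: "\<lbrakk>a \<in> carrier R; b \<in> two_sided_multiples R a\<rbrakk>
      \<Longrightarrow> \<exists>x\<in>carrier R. \<exists>y\<in>carrier R. b = x \<otimes> a \<otimes> y"

definition purely_infinite_ideal :: "'a set \<Rightarrow> ('a, 'm) ring_scheme \<Rightarrow> bool" where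
  "purely_infinite_ideal I R \<longleftrightarrow>
     nonunital_ideal I R \<and> purely_infinite_ring (R\<lparr>carrier := I\<rparr>)"

section \<open>Free algebras\<close>

text \<open>
  With concatenation as the monoid operation on words, the convolution product of
  \<^theory>\<open>HOL-Library.Poly_Mapping\<close> on finitely supported functions \<open>'g list \<Rightarrow>\<^sub>0 'k\<close> is the
  product of noncommutative polynomials.
\<close>

instantiation list :: (type) monoid_add
begin
definition zero_list_def: "0 = ([] :: 'a list)"
definition plus_list_def: "xs + ys = (xs @ ys :: 'a list)"
instance by standard (simp_all add: zero_list_def plus_list_def)
end

definition free_algebra :: "'g set \<Rightarrow> ('g list \<Rightarrow>\<^sub>0 'k::field) ring" where
  "free_algebra X = \<lparr>carrier = {p. \<forall>w\<in>Poly_Mapping.keys p. set w \<subseteq> X},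
     mult = (*), one = 1, zero = 0, add = (+)\<rparr>"

text \<open>The free algebra without unit: only nonempty words occur.\<close>

definition free_nonunital_algebra :: "'g set \<Rightarrow> ('g list \<Rightarrow>\<^sub>0 'k::field) ring" where
  "free_nonunital_algebra X =
     (free_algebra X)\<lparr>carrier := {p \<in> carrier (free_algebra X). [] \<notin> Poly_Mapping.keys p}\<rparr>"

section \<open>Leavitt path algebras\<close>

datatype ('v, 'e) lpa_gen = Vertex 'v | Edge 'e | Ghost 'e

definition lpa_gens :: "('v, 'e) pre_digraph \<Rightarrow> ('v, 'e) lpa_gen set" where
  "lpa_gens E = Vertex ` verts E \<union> Edge ` arcs E \<union> Ghost ` arcs E"

abbreviation vtx :: "'v \<Rightarrow> ('v, 'e) lpa_gen list \<Rightarrow>\<^sub>0 'k::field" where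
  "vtx v \<equiv> Poly_Mapping.single [Vertex v] 1"

abbreviation edge :: "'e \<Rightarrow> ('v, 'e) lpa_gen list \<Rightarrow>\<^sub>0 'k::field" where
  "edge e \<equiv> Poly_Mapping.single [Edge e] 1"

abbreviation ghost :: "'e \<Rightarrow> ('v, 'e) lpa_gen list \<Rightarrow>\<^sub>0 'k::field" where
  "ghost e \<equiv> Poly_Mapping.single [Ghost e] 1"

text \<open>A relation \<open>l = r\<close> is recorded as the element \<open>l - r\<close> of the free algebra.\<close>

inductive_set lpa_relators ::
  "('v, 'e) pre_digraph \<Rightarrow> (('v, 'e) lpa_gen list \<Rightarrow>\<^sub>0 'k::field) set" for E where
  vertex_vertex: "\<lbrakk>v \<in> verts E; w \<in> verts E\<rbrakk>
    \<Longrightarrow> vtx v * vtx w - (if v = w then vtx v else 0) \<in> lpa_relators E"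
| source_edge: "e \<in> arcs E \<Longrightarrow> vtx (tail E e) * edge e - edge e \<in> lpa_relators E"
| edge_range: "e \<in> arcs E \<Longrightarrow> edge e * vtx (head E e) - edge e \<in> lpa_relators E"
| range_ghost: "e \<in> arcs E \<Longrightarrow> vtx (head E e) * ghost e - ghost e \<in> lpa_relators E"
| ghost_source: "e \<in> arcs E \<Longrightarrow> ghost e * vtx (tail E e) - ghost e \<in> lpa_relators E"
| CK1: "\<lbrakk>e \<in> arcs E; f \<in> arcs E\<rbrakk>
    \<Longrightarrow> ghost e * edge f - (if e = f then vtx (head E e) else 0) \<in> lpa_relators E"
| CK2: "pre_digraph.regular_vertex E v
    \<Longrightarrow> vtx v - (\<Sum>e\<in>out_arcs E v. edge e * ghost e) \<in> lpa_relators E"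

text \<open>
  The ideal is taken in the unital free algebra, so it is closed under multiplication by scalars.
  As no relator has a constant term, it is contained in the nonunital free algebra, and it is the
  algebra ideal generated there by the relators.
\<close>

definition lpa_ideal ::
  "('v, 'e) pre_digraph \<Rightarrow> (('v, 'e) lpa_gen list \<Rightarrow>\<^sub>0 'k::field) set" where
  "lpa_ideal E = Idl\<^bsub>free_algebra (lpa_gens E)\<^esub> (lpa_relators E)"

text \<open>\<open>L\<^sub>K(E)\<close> is \<open>lpa TYPE('k) E\<close>, where the type \<open>'k\<close> is the field \<open>K\<close>.\<close>

definition lpa :: "'k::field itself \<Rightarrow> ('v, 'e) pre_digraph
    \<Rightarrow> (('v, 'e) lpa_gen list \<Rightarrow>\<^sub>0 'k) set ring" where
  "lpa K E = free_nonunital_algebra (lpa_gens E) Quot lpa_ideal E"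

definition lpa_vertex :: "'k::field itself \<Rightarrow> ('v, 'e) pre_digraph \<Rightarrow> 'v
    \<Rightarrow> (('v, 'e) lpa_gen list \<Rightarrow>\<^sub>0 'k) set" where
  "lpa_vertex K E v = lpa_ideal E +>\<^bsub>free_nonunital_algebra (lpa_gens E)\<^esub> vtx v"

end

theory Submission
  imports Defs "HOL-Library.Sublist"
begin

text \<open>
  Call a vertex \<open>v\<close> recurrent if every path leaving \<open>v\<close> can be continued back to \<open>v\<close> and there are
  two closed paths \<open>g\<close>, \<open>h\<close> at \<open>v\<close>, neither a prefix of the other; the vertices of extreme cycles are
  recurrent. Then \<open>g\<^sup>* h = 0\<close> while \<open>g\<^sup>* g = h\<^sup>* h = v\<close>, which excludes division rings as quotients, and
  the paths \<open>g\<^sup>k h\<close> are pairwise orthogonal.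

  For the factorisation, a nonzero \<open>z \<in> w L v\<close> with \<open>v\<close> recurrent satisfies \<open>p z q = v\<close> for some \<open>p\<close>, \<open>q\<close>:
  multiplying by edges removes the ghost paths; multiplying the resulting combination of real paths
  by \<open>p\<^sub>0\<^sup>*\<close> for a shortest path \<open>p\<^sub>0\<close> in it leaves a multiple of \<open>v\<close> plus closed paths of positive length; and
  conjugation by a suitable \<open>g\<^sup>k h\<close> kills these, because a closed path has at most one of the
  \<open>g\<^sup>k h\<close> as a prefix of its infinite power. Hence \<open>b \<in> J a J\<close> is a sum of terms \<open>A\<^sub>i u\<^sub>i B\<^sub>i\<close> in which
  \<open>p\<^sub>i a q\<^sub>i\<close> is a vertex \<open>v\<^sub>i\<close> depending only on the component of \<open>u\<^sub>i\<close>, and with orthogonal paths \<open>t\<^sub>i\<close>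
  from \<open>v\<^sub>i\<close> to \<open>u\<^sub>i\<close> one gets \<open>b = (\<Sum>A\<^sub>i t\<^sub>i\<^sup>* p\<^sub>i) a (\<Sum>q\<^sub>j t\<^sub>j B\<^sub>j)\<close>. The mixed terms vanish since \<open>v L w = 0\<close> for
  recurrent \<open>v\<close>, \<open>w\<close> in different components.

  No basis of \<open>L\<close> is needed. The computations take place in a type-class ring
  satisfying the Leavitt relations, into which \<open>L\<close> is embedded.
\<close>

section \<open>Additive spans\<close>

text \<open>Only finite sums are formed, which gives an induction over one generator at a time.
  Negatives come from generating sets that are themselves closed under negation.\<close>

inductive_set additive_span :: "'r::ab_group_add set \<Rightarrow> 'r set" for B where
  zero: "0 \<in> additive_span B"
| add: "\<lbrakk>b \<in> B; x \<in> additive_span B\<rbrakk> \<Longrightarrow> b + x \<in> additive_span B"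

lemma additive_span_base: "b \<in> B \<Longrightarrow> b \<in> additive_span B"
  using additive_span.add[OF _ additive_span.zero] by fastforce

lemma additive_span_plus:
  "\<lbrakk>x \<in> additive_span B; y \<in> additive_span B\<rbrakk> \<Longrightarrow> x + y \<in> additive_span B"
  by (induction rule: additive_span.induct) (auto simp: add.assoc intro: additive_span.intros)

lemma additive_span_sum:
  "(\<And>i. i \<in> A \<Longrightarrow> f i \<in> additive_span B) \<Longrightarrow> sum f A \<in> additive_span B"
  by (induction A rule: infinite_finite_induct)
    (auto intro: additive_span.zero additive_span_plus)

lemma additive_span_subset:
  assumes "\<And>b. b \<in> B \<Longrightarrow> b \<in> additive_span C" and "x \<in> additive_span B"
  shows "x \<in> additive_span C"
  using assms(2) by induction (auto intro: additive_span.zero additive_span_plus assms(1))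

lemma additive_span_uminus:
  assumes "\<And>b. b \<in> B \<Longrightarrow> - b \<in> additive_span B" and "x \<in> additive_span B"
  shows "- x \<in> additive_span B"
  using assms(2)
proof induction
  case (add b x)
  then show ?case unfolding minus_add_distrib by (blast intro: additive_span_plus assms(1))
qed (simp add: additive_span.zero)

lemma additive_span_mult_left:
  fixes a :: "'r::ring"
  assumes "\<And>b. b \<in> B \<Longrightarrow> a * b \<in> additive_span C" and "x \<in> additive_span B"
  shows "a * x \<in> additive_span C"
  using assms(2)
  by induction (auto simp: distrib_left intro: additive_span.zero additive_span_plus assms(1))

lemma additive_span_mult_right:
  fixes a :: "'r::ring"
  assumes "\<And>b. b \<in> B \<Longrightarrow> b * a \<in> additive_span C" and "x \<in> additive_span B"
  shows "x * a \<in> additive_span C"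
  using assms(2)
  by induction (auto simp: distrib_right intro: additive_span.zero additive_span_plus assms(1))

lemma additive_span_sumE:
  assumes "x \<in> additive_span B"
  obtains n :: nat and f where "\<And>i. i < n \<Longrightarrow> f i \<in> B" and "x = (\<Sum>i<n. f i)"
proof -
  have "\<exists>(n::nat) f. (\<forall>i<n. f i \<in> B) \<and> x = (\<Sum>i<n. f i)"
    using assms
  proof induction
    case zero
    show ?case by (intro exI[of _ 0]) simp
  next
    case (add b x)
    then obtain n :: nat and f where "\<forall>i<n. f i \<in> B" "x = (\<Sum>i<n. f i)" by blast
    with add show ?case
      by (intro exI[of _ "Suc n"] exI[of _ "f(n := b)"]) (auto simp: less_Suc_eq add.commute)
  qed
  then show thesis using that by blast
qed

lemma additive_span_empty: "x \<in> additive_span {} \<Longrightarrow> x = 0"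
  by (induction rule: additive_span.induct) auto

text \<open>Changing one value of a finitely supported function by \<open>b\<close> changes the sum
  by \<open>b\<close>, whether or not \<open>p\<close> was already an index. This absorbs one more
  monomial into a decomposition with coefficient functions.\<close>

lemma sum_fun_upd_plus:
  fixes f :: "'x \<Rightarrow> 'y::comm_monoid_add"
  assumes "finite S" "\<And>x. x \<notin> S \<Longrightarrow> f x = 0"
  shows "(\<Sum>x\<in>insert p S. (f(p := f p + b)) x) = (\<Sum>x\<in>S. f x) + b"
proof -
  have "(\<Sum>x\<in>insert p S. (f(p := f p + b)) x) = f p + b + (\<Sum>x\<in>S - {p}. f x)"
    using assms(1) by (subst sum.insert_remove) auto
  also have "\<dots> = (f p + (\<Sum>x\<in>S - {p}. f x)) + b" by (simp add: ac_simps)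
  also have "f p + (\<Sum>x\<in>S - {p}. f x) = (\<Sum>x\<in>S. f x)"
    using assms by (cases "p \<in> S") (auto simp: sum.remove)
  finally show ?thesis .
qed

section \<open>Recurrent vertices\<close>

lemma prefix_concat_replicate:
  assumes "prefix t (g @ t)"
  shows "prefix t (concat (replicate n g) @ t)"
proof (induction n)
  case (Suc n)
  have "prefix (g @ t) (g @ concat (replicate n g) @ t)" using Suc by simp
  with assms show ?case by (metis append_assoc concat.simps(2) prefix_order.trans replicate_Suc)
qed simp

text \<open>Both words are prefixes of the infinite power of \<open>g\<close>.\<close>

lemma prefix_power_comparable:
  assumes "prefix s (g @ s)" "prefix t (g @ t)" "g \<noteq> []"
  shows "prefix s t \<or> prefix t s"
proof -
  \<comment> \<open>\<open>W\<close> is a power of \<open>g\<close> long enough to contain both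
    \<open>s\<close> and \<open>t\<close>.\<close>
  define n where "n = length s + length t"
  define W where "W = concat (replicate n g)"
  have "length W = n * length g"
    by (simp add: W_def length_concat sum_list_replicate)
  moreover have "length g \<ge> 1" using assms(3) by (cases g) auto
  ultimately have len: "length W \<ge> n" by simp
  have "prefix s (W @ s)" "prefix t (W @ t)"
    using assms prefix_concat_replicate unfolding W_def by blast+
  then have "prefix s W" "prefix t W"
    using len unfolding n_def by (auto intro: prefix_length_prefix)
  then show ?thesis by (rule prefix_same_cases)
qed

text \<open>Cancelling the common power of \<open>g\<close> leaves a comparison of \<open>h\<close>
  with a word that starts with \<open>g\<close>.\<close>

lemma prefix_comparable_power_append:
  assumes "i < j" "prefix (concat (replicate i g) @ h) (concat (replicate j g) @ h)
    \<or> prefix (concat (replicate j g) @ h) (concat (replicate i g) @ h)"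
  shows "prefix g h \<or> prefix h g"
proof -
  obtain k where j: "j = i + Suc k" using assms(1) less_iff_Suc_add by auto
  have "concat (replicate j g) @ h = concat (replicate i g) @ g @ concat (replicate k g) @ h"
    unfolding j replicate_add by simp
  with assms(2) have "prefix h (g @ concat (replicate k g) @ h)
      \<or> prefix (g @ concat (replicate k g) @ h) h"
    by simp
  then show ?thesis
    by (meson prefixI prefix_order.trans prefix_same_cases)
qed

section \<open>Recurrent vertices and extreme cycles\<close>

context wf_digraph
begin

text \<open>As elimination rules these make the classical reasoner diverge.\<close>

declare awalkE [rule del] awalkE' [rule del]
declare awalk_hd_in_verts [dest] awalk_last_in_verts [dest]

lemma awalk_append_split:
  assumes "awalk u (p @ q) v" obtains w where "awalk u p w" "awalk w q v"
  using assms by auto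

lemma awalk_suffix:
  assumes "awalk u (p @ q) v" "awalk u p w" shows "awalk w q v"
  using assms by auto

text \<open>The condition speaks of a vertex and not of a cycle, so that it passes along paths. The
  two incomparable closed paths stand for a cycle and a detour through one of its exits.\<close>

definition recurrent :: "'a \<Rightarrow> bool" where
  "recurrent v \<longleftrightarrow> v \<in> verts G \<and> (\<forall>p w. awalk v p w \<longrightarrow> (\<exists>q. awalk w q v)) \<and>
     (\<exists>g h. awalk v g v \<and> awalk v h v \<and> \<not> prefix g h \<and> \<not> prefix h g)"

lemma recurrent_in_verts: "recurrent v \<Longrightarrow> v \<in> verts G"
  by (simp add: recurrent_def)

lemma recurrent_returns: "\<lbrakk>recurrent v; awalk v p w\<rbrakk> \<Longrightarrow> \<exists>q. awalk w q v"
  by (auto simp: recurrent_def)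

text \<open>A path \<open>q\<close> back from \<open>w\<close> to \<open>v\<close> turns
  \<open>g\<close> and \<open>h\<close> into the closed paths \<open>q @ g @ p\<close> and
  \<open>q @ h @ p\<close> at \<open>w\<close>. Comparability of these would pass to
  \<open>g\<close> and \<open>h\<close> after cancelling \<open>q\<close>. A path leaving
  \<open>w\<close> is continued back to \<open>v\<close> and then along \<open>p\<close>.\<close>

lemma recurrent_hereditary:
  assumes "recurrent v" "awalk v p w" shows "recurrent w"
proof -
  obtain q where q: "awalk w q v" using recurrent_returns assms by blast
  obtain g h where gh: "awalk v g v" "awalk v h v" "\<not> prefix g h" "\<not> prefix h g"
    using assms(1) by (auto simp: recurrent_def)
  have "\<exists>s. awalk x s w" if "awalk w r x" for r x
    by (meson assms awalk_appendI recurrent_returns that)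
  moreover have "awalk w (q @ g @ p) w" "awalk w (q @ h @ p) w"
    using q gh assms(2) by (meson awalk_appendI)+
  moreover have "\<not> prefix (q @ g @ p) (q @ h @ p)" "\<not> prefix (q @ h @ p) (q @ g @ p)"
    using gh(3,4) by (metis prefix_def prefix_same_cases same_prefix_prefix append_assoc)+
  ultimately show ?thesis using assms(2) unfolding recurrent_def by blast
qed

text \<open>Of two incomparable paths neither is empty, so some edge leaves \<open>v\<close>. With
  finitely many outgoing edges, a recurrent vertex is therefore regular.\<close>

lemma recurrent_not_sink:
  assumes "recurrent v" shows "out_arcs G v \<noteq> {}"
proof -
  obtain g where "awalk v g v" "g \<noteq> []"
    using assms by (auto simp: recurrent_def)
  then show ?thesis by (cases g) (auto simp: awalk_Cons_iff out_arcs_def)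
qed

text \<open>The family consists of the paths formed by \<open>k\<close> copies of \<open>g\<close>
  followed by \<open>h\<close>.\<close>

lemma recurrent_incomparable_family:
  assumes "recurrent v"
  shows "\<exists>t :: nat \<Rightarrow> 'b list. (\<forall>k. awalk v (t k) v) \<and> (\<forall>i j. i \<noteq> j \<longrightarrow> \<not> prefix (t i) (t j))"
proof -
  obtain g h where gh: "awalk v g v" "awalk v h v" "\<not> prefix g h" "\<not> prefix h g"
    using assms by (auto simp: recurrent_def)
  define t where "t k = concat (replicate k g) @ h" for k
  have "awalk v (concat (replicate k g)) v" for k
    by (induction k) (auto simp: awalk_Nil_iff recurrent_in_verts assms simp del: awalk_append_iff intro: awalk_appendI gh)
  then have "awalk v (t k) v" for k
    unfolding t_def using gh(2) by (blast intro: awalk_appendI)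
  moreover have "\<not> prefix (t i) (t j)" if "i \<noteq> j" for i j
    using prefix_comparable_power_append[of i j g h] prefix_comparable_power_append[of j i g h] that gh(3,4)
    unfolding t_def by (metis linorder_neqE_nat)
  ultimately show ?thesis by blast
qed

text \<open>In a family of pairwise incomparable closed paths, each \<open>g\<close> in
  \<open>S\<close> rules out at most one member: two members \<open>t i\<close>, \<open>t j\<close>
  that are prefixes of \<open>g @ t i\<close> and \<open>g @ t j\<close> would be comparable. A
  finite \<open>S\<close> therefore leaves some member over.\<close>

lemma recurrent_avoids_powers:
  assumes "recurrent v" "finite S" "[] \<notin> S"
  obtains t where "awalk v t v" "\<And>g. g \<in> S \<Longrightarrow> \<not> prefix t (g @ t)"
proof -
  obtain t :: "nat \<Rightarrow> 'b list"
    where t: "\<forall>k. awalk v (t k) v" "\<forall>i j. i \<noteq> j \<longrightarrow> \<not> prefix (t i) (t j)"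
    using recurrent_incomparable_family[OF assms(1)] by metis
  have "finite {k. prefix (t k) (g @ t k)}" if "g \<in> S" for g
  proof -
    have "i = j" if "prefix (t i) (g @ t i)" "prefix (t j) (g @ t j)" for i j
      using prefix_power_comparable[OF that] t(2) \<open>g \<in> S\<close> assms(3) by metis
    then have "{k. prefix (t k) (g @ t k)} \<subseteq> {i}" if "prefix (t i) (g @ t i)" for i
      using that by auto
    then show ?thesis by (metis (mono_tags, lifting) Collect_empty_eq finite.simps finite_subset)
  qed
  then have "finite (\<Union>g\<in>S. {k. prefix (t k) (g @ t k)})" using assms(2) by blast
  then obtain k where "k \<notin> (\<Union>g\<in>S. {k. prefix (t k) (g @ t k)})"
    using ex_new_if_finite infinite_UNIV_nat by blast
  then show thesis using that[of "t k"] t(1) by blast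
qed

lemma closed_awalk_rotate:
  assumes "awalk u c u" "v \<in> cycle_verts c"
  obtains d where "awalk v d v" "set d = set c"
proof -
  obtain f where f: "f \<in> set c" "tail G f = v" using assms(2) by auto
  then obtain a b where c: "c = a @ f # b" by (meson split_list)
  obtain w where w: "awalk u a w" "awalk w (f # b) u"
    using assms(1) awalk_append_split c by blast
  with f have "w = v" by (simp add: awalk_Cons_iff)
  then have "awalk v ((f # b) @ a) v" using w awalk_appendI by blast
  then show thesis using that[of "(f # b) @ a"] c by auto
qed

text \<open>Rotated to start at \<open>v\<close>, the cycle is one closed path
  \<open>a @ f # b\<close>. The other follows \<open>a\<close>, leaves through the exit
  \<open>e\<close> and is led back to \<open>v\<close> by extremeness. The two differ at
  \<open>e\<close> against \<open>f\<close>, right after \<open>a\<close>.\<close>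

lemma P_ec_recurrent:
  assumes "v \<in> P_ec" shows "recurrent v"
proof -
  obtain c where c: "extreme_cycle c" "v \<in> cycle_verts c"
    using assms by (auto simp: P_ec_def)
  then obtain u where u: "awalk u c u" unfolding extreme_cycle_def cycle_def by blast
  have between: "\<exists>q. awalk w q x" if "w \<in> cycle_verts c" "x \<in> cycle_verts c" for w x
  proof -
    note w = that(1) and x = that(2)
    obtain d where d: "awalk w d w" "set d = set c"
      by (rule closed_awalk_rotate[OF u w])
    with x obtain f where "f \<in> set d" "tail G f = x" by auto
    then obtain a b where f: "d = a @ f # b" "tail G f = x" by (meson split_list)
    obtain y where "awalk w a y" "awalk y (f # b) w"
      using d(1) unfolding f(1) by (rule awalk_append_split)
    with f(2) show ?thesis by (auto simp: awalk_Cons_iff)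
  qed
  \<comment> \<open>Extremeness leads back only to some vertex of the cycle. The rest of the way
    follows the cycle.\<close>
  have returns: "\<exists>q. awalk w q v" if "awalk v p w" for p w
  proof -
    have "\<exists>q. \<exists>x\<in>cycle_verts c. awalk w q x"
      using c(1)[unfolded extreme_cycle_def, THEN conjunct2, THEN conjunct2, rule_format, OF c(2) that] .
    then obtain q x where x: "x \<in> cycle_verts c" "awalk w q x" by blast
    obtain r where "awalk x r v" using between[OF x(1) c(2)] by blast
    with x(2) show ?thesis using awalk_appendI by blast
  qed
  obtain e f where e: "e \<in> arcs G" "f \<in> set c" "tail G e = tail G f" "e \<noteq> f"
    using c(1) by (auto simp: extreme_cycle_def is_exit_def)
  obtain d where d: "awalk v d v" "set d = set c"
    by (rule closed_awalk_rotate[OF u c(2)])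
  then obtain a b where ab: "d = a @ f # b" using e(2) by (metis split_list)
  then obtain w where w: "awalk v a w" "awalk w (f # b) v"
    using d(1) awalk_append_split by blast
  then have "awalk w [e] (head G e)" using e by (auto simp: awalk_simps)
  then have "awalk v (a @ [e]) (head G e)" using w awalk_appendI by blast
  then obtain q where "awalk (head G e) q v" using returns by blast
  with \<open>awalk v (a @ [e]) (head G e)\<close> have "awalk v ((a @ [e]) @ q) v"
    using awalk_appendI by blast
  moreover have "\<not> prefix ((a @ [e]) @ q) d" "\<not> prefix d ((a @ [e]) @ q)"
    using e(4) ab by auto
  moreover have "v \<in> verts G" using d(1) by auto
  ultimately show ?thesis using d(1) returns unfolding recurrent_def by blast
qed

end

section \<open>Computation with paths\<close>

text \<open>Only the defining relations are assumed, without any linear independence. The class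
  \<open>ring\<close> has no unit and no scalars, so a scalar is a ring element \<open>sc c\<close>
  commuting with the generators, and \<open>sc 1\<close> acts as an identity on vertices.\<close>

locale leavitt_family = wf_digraph G for G :: "('a, 'b) pre_digraph" (structure) +
  fixes vx :: "'a \<Rightarrow> 'r::ring" and ed gh :: "'b \<Rightarrow> 'r" and sc :: "'k::field \<Rightarrow> 'r"
  assumes vx_vx: "\<lbrakk>v \<in> verts G; w \<in> verts G\<rbrakk> \<Longrightarrow> vx v * vx w = (if v = w then vx v else 0)"
    and tail_ed: "e \<in> arcs G \<Longrightarrow> vx (tail G e) * ed e = ed e"
    and ed_head: "e \<in> arcs G \<Longrightarrow> ed e * vx (head G e) = ed e"
    and head_gh: "e \<in> arcs G \<Longrightarrow> vx (head G e) * gh e = gh e"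
    and gh_tail: "e \<in> arcs G \<Longrightarrow> gh e * vx (tail G e) = gh e"
    and gh_ed: "\<lbrakk>e \<in> arcs G; f \<in> arcs G\<rbrakk> \<Longrightarrow> gh e * ed f = (if e = f then vx (head G e) else 0)"
    and vx_regular: "regular_vertex v \<Longrightarrow> vx v = (\<Sum>e\<in>out_arcs G v. ed e * gh e)"
    and sc_add: "sc (c + d) = sc c + sc d"
    and sc_mult: "sc (c * d) = sc c * sc d"
    and sc_one: "v \<in> verts G \<Longrightarrow> sc 1 * vx v = vx v"
    and sc_vx: "v \<in> verts G \<Longrightarrow> vx v * sc c = sc c * vx v"
    and sc_ed: "e \<in> arcs G \<Longrightarrow> ed e * sc c = sc c * ed e"
    and sc_gh: "e \<in> arcs G \<Longrightarrow> gh e * sc c = sc c * gh e"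
begin

section \<open>Real and ghost paths and their products\<close>

primrec rp :: "'b list \<Rightarrow> 'a \<Rightarrow> 'r" where
  "rp [] u = vx u"
| "rp (e # p) u = ed e * rp p u"

text \<open>The adjoint of \<open>rp p u\<close>, with the factors in reverse order. In both
  functions \<open>u\<close> is the range of the path, which supplies the value for length
  zero.\<close>

primrec gp :: "'b list \<Rightarrow> 'a \<Rightarrow> 'r" where
  "gp [] u = vx u"
| "gp (e # p) u = gp p u * gh e"

lemma vx_rp:
  assumes "awalk w p u" "v \<in> verts G"
  shows "vx v * rp p u = (if v = w then rp p u else 0)"
proof (cases p)
  case (Cons e q)
  then have e: "e \<in> arcs G" "tail G e = w" using assms(1) by (auto simp: awalk_Cons_iff)
  have w: "vx w * ed e = ed e" using tail_ed e by auto
  have "vx v * rp p u = vx v * (vx w * ed e) * rp q u"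
    unfolding w by (simp add: Cons mult.assoc)
  also have "\<dots> = (vx v * vx w) * ed e * rp q u" by (simp add: mult.assoc)
  also have "\<dots> = (if v = w then vx w * ed e * rp q u else 0)"
    using assms(2) e by (auto simp: vx_vx)
  finally show ?thesis unfolding w by (simp add: Cons)
qed (use assms in \<open>auto simp: awalk_Nil_iff vx_vx\<close>)

lemma gp_vx:
  assumes "awalk w p u" "v \<in> verts G"
  shows "gp p u * vx v = (if v = w then gp p u else 0)"
proof (cases p)
  case (Cons e q)
  then have e: "e \<in> arcs G" "tail G e = w" using assms(1) by (auto simp: awalk_Cons_iff)
  have w: "gh e * vx w = gh e" using gh_tail e by auto
  have "gp p u * vx v = gp q u * (gh e * vx w) * vx v"
    unfolding w by (simp add: Cons)
  also have "\<dots> = gp q u * (gh e * (vx w * vx v))" by (simp add: mult.assoc)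
  also have "\<dots> = (if v = w then gp q u * (gh e * vx w) else 0)"
    using assms(2) e by (auto simp: vx_vx)
  finally show ?thesis unfolding w by (simp add: Cons)
qed (use assms in \<open>auto simp: awalk_Nil_iff vx_vx\<close>)

lemma rp_vx:
  assumes "awalk w p u" "v \<in> verts G"
  shows "rp p u * vx v = (if v = u then rp p u else 0)"
  using assms by (induction p arbitrary: w) (auto simp: awalk_simps vx_vx mult.assoc)

lemma vx_gp:
  assumes "awalk w p u" "v \<in> verts G"
  shows "vx v * gp p u = (if v = u then gp p u else 0)"
  using assms
  by (induction p arbitrary: w) (auto simp: awalk_simps vx_vx mult.assoc[symmetric])

lemma rp_append:
  assumes "awalk w p u" "awalk u q x"
  shows "rp (p @ q) x = rp p u * rp q x"
  using assms
  by (induction p arbitrary: w) (auto simp: awalk_simps vx_rp mult.assoc)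

lemma gp_append:
  assumes "awalk w p u" "awalk u q x"
  shows "gp (p @ q) x = gp q x * gp p u"
  using assms
  by (induction p arbitrary: w) (auto simp: awalk_simps gp_vx mult.assoc)

text \<open>The relation \<open>gh_ed\<close> cancels equal first edges and kills different ones.
  All comparisons of a ghost path with a real path rest on this step.\<close>

lemma gp_rp_Cons:
  assumes "awalk w (e # p) u" "awalk w' (f # q) x"
  shows "gp (e # p) u * rp (f # q) x = (if e = f then gp p u * rp q x else 0)"
proof -
  have ef: "e \<in> arcs G" "f \<in> arcs G" "awalk (head G e) p u"
    using assms by (auto simp: awalk_Cons_iff)
  have "gp (e # p) u * rp (f # q) x = gp p u * (gh e * ed f) * rp q x"
    by (simp add: mult.assoc)
  also have "\<dots> = (if e = f then (gp p u * vx (head G e)) * rp q x else 0)"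
    using ef by (simp add: gh_ed)
  finally show ?thesis using ef by (simp add: gp_vx)
qed

lemma gp_rp_same: "awalk w p u \<Longrightarrow> gp p u * rp p u = vx u"
proof (induction p arbitrary: w)
  case (Cons e p)
  then show ?case using gp_rp_Cons[OF Cons.prems Cons.prems] by (auto simp: awalk_Cons_iff simp del: gp.simps rp.simps)
qed (auto simp: awalk_Nil_iff vx_vx)

text \<open>Cancelling equal first edges must arrive at two different edges, because neither list
  can run out first.\<close>

lemma gp_rp_incomparable:
  assumes "awalk w p u" "awalk w' q x" "\<not> prefix p q" "\<not> prefix q p"
  shows "gp p u * rp q x = 0"
  using assms
proof (induction p arbitrary: w w' q)
  case (Cons e p)
  then obtain f q' where q: "q = f # q'" by (cases q) auto
  show ?case
  proof (cases "e = f")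
    case True
    then have "gp p u * rp q' x = 0"
      using Cons.prems q by (auto intro!: Cons.IH simp: awalk_Cons_iff)
    then show ?thesis using gp_rp_Cons[of w e p u w' f q' x] Cons.prems q True by simp
  next
    case False
    then show ?thesis using gp_rp_Cons[of w e p u w' f q' x] Cons.prems q by simp
  qed
qed simp

text \<open>The start vertices can be inserted between the factors and are orthogonal. This includes
  empty paths, which are prefixes of every path.\<close>

lemma gp_rp_source:
  assumes "awalk w p u" "awalk w' q x" "w \<noteq> w'"
  shows "gp p u * rp q x = 0"
proof -
  have v: "w \<in> verts G" "w' \<in> verts G" using assms by auto
  have "gp p u * rp q x = (gp p u * vx w) * (vx w' * rp q x)"
    using assms v by (simp add: gp_vx vx_rp)
  also have "\<dots> = gp p u * (vx w * vx w') * rp q x" by (simp only: mult.assoc)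
  finally show ?thesis using v assms(3) by (simp add: vx_vx)
qed

lemma gp_rp_prefix:
  assumes "awalk w p u" "awalk u r x"
  shows "gp p u * rp (p @ r) x = rp r x"
proof -
  have "gp p u * rp (p @ r) x = gp p u * rp p u * rp r x"
    using assms by (simp add: rp_append mult.assoc)
  then show ?thesis
    using assms by (auto simp: gp_rp_same vx_rp)
qed

lemma gp_prefix_rp:
  assumes "awalk w p u" "awalk u r x"
  shows "gp (p @ r) x * rp p u = gp r x"
proof -
  have "gp (p @ r) x * rp p u = gp r x * (gp p u * rp p u)"
    using assms by (simp add: gp_append mult.assoc)
  moreover have "u \<in> verts G" using assms(2) by auto
  ultimately show ?thesis
    using assms by (simp add: gp_rp_same gp_vx)
qed

lemma sc_rp: "awalk w p u \<Longrightarrow> rp p u * sc c = sc c * rp p u"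
proof (induction p arbitrary: w)
  case (Cons e p)
  then have "rp p u * sc c = sc c * rp p u" "e \<in> arcs G" by (auto simp: awalk_Cons_iff)
  then show ?case by (metis (no_types) mult.assoc rp.simps(2) sc_ed)
qed (auto simp: sc_vx awalk_Nil_iff)

lemma sc_gp: "awalk w p u \<Longrightarrow> gp p u * sc c = sc c * gp p u"
proof (induction p arbitrary: w)
  case (Cons e p)
  then have "gp p u * sc c = sc c * gp p u" "e \<in> arcs G" by (auto simp: awalk_Cons_iff)
  then show ?case by (metis (no_types) mult.assoc gp.simps(2) sc_gh)
qed (auto simp: sc_vx awalk_Nil_iff)

lemma sc_zero: "sc 0 = 0"
  using sc_add[of 0 0] by simp

lemma sc_one_mult: "v \<in> verts G \<Longrightarrow> vx v * x = x \<Longrightarrow> sc 1 * x = x"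
  by (metis mult.assoc sc_one)

section \<open>Monomials, their span and its corners\<close>

definition monomials :: "'a \<Rightarrow> 'a \<Rightarrow> nat \<Rightarrow> 'r set" where
  "monomials v w m = {sc c * (rp p u * gp q u) |c p q u. awalk v p u \<and> awalk w q u \<and> length q < m}"

text \<open>In the concrete case this is the image of the Leavitt path algebra. The elements
  \<open>sc c\<close> belong to the ambient ring and need not lie in it.\<close>

definition leavitt_span :: "'r set" where
  "leavitt_span = additive_span (\<Union>v w m. monomials v w m)"

lemma monomialsI:
  "\<lbrakk>awalk v p u; awalk w q u; length q < m\<rbrakk> \<Longrightarrow> sc c * (rp p u * gp q u) \<in> monomials v w m"
  unfolding monomials_def by blast

lemma monomials_in_span:
  "\<lbrakk>awalk v p u; awalk w q u\<rbrakk> \<Longrightarrow> sc c * (rp p u * gp q u) \<in> leavitt_span"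
  unfolding leavitt_span_def
  by (rule additive_span_base) (use monomialsI[of v p u w q "Suc (length q)" c] in auto)

text \<open>Everything depends on the inner product of \<open>gp q u\<close> and
  \<open>rp p' u'\<close>. It vanishes for different sources or incomparable paths; otherwise the
  rest of the longer path remains and extends either \<open>p\<close> or \<open>q'\<close>. Sources
  are compared before prefixes, since an empty path is a prefix of paths from other vertices
  too.\<close>

lemma monomial_mult:
  assumes "awalk v p u" "awalk w q u" "awalk v' p' u'" "awalk w' q' u'"
  shows "(sc c * (rp p u * gp q u)) * (sc d * (rp p' u' * gp q' u')) \<in> leavitt_span"
proof -
  have eq: "(sc c * (rp p u * gp q u)) * (sc d * (rp p' u' * gp q' u'))
      = sc (c * d) * (rp p u * (gp q u * rp p' u') * gp q' u')"
  proof -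
    have "(rp p u * gp q u) * sc d = sc d * (rp p u * gp q u)"
      by (metis mult.assoc sc_gp sc_rp assms(1,2))
    then have "sc c * (rp p u * gp q u) * sc d = sc c * sc d * (rp p u * gp q u)"
      by (simp add: mult.assoc)
    then show ?thesis by (simp add: sc_mult mult.assoc[symmetric])
  qed
  consider "w \<noteq> v'" | "w = v'" "prefix q p'" | "w = v'" "prefix p' q"
    | "\<not> prefix q p'" "\<not> prefix p' q" by blast
  then show ?thesis
  proof cases
    case 1
    then show ?thesis
      using eq gp_rp_source[OF assms(2,3)] by (simp add: leavitt_span_def additive_span.zero)
  next
    case 2
    then obtain r where r: "p' = q @ r" by (auto simp: prefix_def)
    then have ar: "awalk u r u'" using 2 assms awalk_suffix by blast
    have "gp q u * rp p' u' = rp r u'" unfolding r by (rule gp_rp_prefix[OF assms(2) ar])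
    then have "sc c * (rp p u * gp q u) * (sc d * (rp p' u' * gp q' u'))
        = sc (c * d) * (rp (p @ r) u' * gp q' u')"
      unfolding eq by (simp add: rp_append[OF assms(1) ar])
    then show ?thesis using monomials_in_span[OF awalk_appendI[OF assms(1) ar] assms(4)] by simp
  next
    case 3
    then obtain r where r: "q = p' @ r" by (auto simp: prefix_def)
    then have ar: "awalk u' r u" using 3 assms awalk_suffix by blast
    have "gp q u * rp p' u' = gp r u" unfolding r by (rule gp_prefix_rp[OF assms(3) ar])
    then have "sc c * (rp p u * gp q u) * (sc d * (rp p' u' * gp q' u'))
        = sc (c * d) * (rp p u * gp (q' @ r) u)"
      unfolding eq by (simp add: gp_append[OF assms(4) ar] mult.assoc)
    then show ?thesis using monomials_in_span[OF assms(1) awalk_appendI[OF assms(4) ar]] by simp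
  next
    case 4
    then show ?thesis
      using eq gp_rp_incomparable[OF assms(2,3)] by (simp add: leavitt_span_def additive_span.zero)
  qed
qed

lemma span_mult:
  assumes "x \<in> leavitt_span" "y \<in> leavitt_span" shows "x * y \<in> leavitt_span"
  using assms(2) unfolding leavitt_span_def
proof (rule additive_span_mult_left[rotated])
  fix b assume b: "b \<in> (\<Union>v w m. monomials v w m)"
  show "x * b \<in> additive_span (\<Union>v w m. monomials v w m)"
    using assms(1) unfolding leavitt_span_def
  proof (rule additive_span_mult_right[rotated])
    fix a assume "a \<in> (\<Union>v w m. monomials v w m)"
    with b show "a * b \<in> additive_span (\<Union>v w m. monomials v w m)"
      unfolding leavitt_span_def[symmetric] by (auto simp: monomials_def intro: monomial_mult)
  qed
qed

lemma span_sum: "(\<And>i. i \<in> A \<Longrightarrow> f i \<in> leavitt_span) \<Longrightarrow> sum f A \<in> leavitt_span"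
  unfolding leavitt_span_def by (rule additive_span_sum)

lemma rp_in_span: assumes "awalk w p u" shows "sc c * rp p u \<in> leavitt_span" "rp p u \<in> leavitt_span"
proof -
  have u: "u \<in> verts G" "w \<in> verts G" using assms by auto
  have *: "sc c * (rp p u * gp [] u) \<in> leavitt_span" for c
    using assms u by (intro monomials_in_span) (auto simp: awalk_Nil_iff)
  show "sc c * rp p u \<in> leavitt_span" using *[of c] rp_vx[OF assms u(1)] by simp
  show "rp p u \<in> leavitt_span"
    using *[of 1] rp_vx[OF assms u(1)] sc_one_mult[OF u(2), of "rp p u"] vx_rp[OF assms u(2)] by simp
qed

lemma gp_in_span: assumes "awalk w p u" shows "sc c * gp p u \<in> leavitt_span" "gp p u \<in> leavitt_span"
proof -
  have u: "u \<in> verts G" using assms by auto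
  have *: "sc c * (rp [] u * gp p u) \<in> leavitt_span" for c
    using assms u by (intro monomials_in_span) (auto simp: awalk_Nil_iff)
  show "sc c * gp p u \<in> leavitt_span" using *[of c] vx_gp[OF assms u] by simp
  show "gp p u \<in> leavitt_span"
    using *[of 1] vx_gp[OF assms u] sc_one_mult[OF u, of "gp p u"] by simp
qed

lemma vx_in_span: "v \<in> verts G \<Longrightarrow> vx v \<in> leavitt_span"
  using rp_in_span(2)[of v "[]" v] by (simp add: awalk_Nil_iff)

lemma ed_in_span: "e \<in> arcs G \<Longrightarrow> ed e \<in> leavitt_span"
  using rp_in_span(2)[of "tail G e" "[e]" "head G e"] by (simp add: awalk_simps ed_head)

text \<open>The part of \<open>v L w\<close> spanned by monomials whose ghost paths are shorter than
  \<open>m\<close>. The bound is the induction parameter for removing ghost paths; as it is strict,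
  \<open>m = 0\<close> leaves only zero and \<open>m = 1\<close> only real paths.\<close>

definition corner :: "'a \<Rightarrow> 'a \<Rightarrow> nat \<Rightarrow> 'r set" where
  "corner v w m = additive_span (monomials v w m)"

lemma corner_mono: "x \<in> corner v w m \<Longrightarrow> m \<le> n \<Longrightarrow> x \<in> corner v w n"
  unfolding corner_def
  by (erule additive_span_subset[rotated]) (force intro: additive_span_base simp: monomials_def)

lemma corner_0: "x \<in> corner v w 0 \<Longrightarrow> x = 0"
  using additive_span_empty[of x] by (simp add: corner_def monomials_def)

lemma monomial_vx:
  assumes "awalk v p u" "awalk w q u" "x \<in> verts G"
  shows "(sc c * (rp p u * gp q u)) * vx x = (if x = w then sc c * (rp p u * gp q u) else 0)"
  using gp_vx[OF assms(2,3)] by (simp add: mult.assoc)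

lemma vx_monomial:
  assumes "awalk v p u" "awalk w q u" "x \<in> verts G"
  shows "vx x * (sc c * (rp p u * gp q u)) = (if x = v then sc c * (rp p u * gp q u) else 0)"
proof -
  have "vx x * (sc c * (rp p u * gp q u)) = (vx x * sc c) * (rp p u * gp q u)"
    by (simp add: mult.assoc)
  also have "\<dots> = sc c * (vx x * rp p u * gp q u)"
    by (simp add: sc_vx assms mult.assoc)
  finally show ?thesis using vx_rp[OF assms(1,3)] by simp
qed

lemma corner_vx:
  assumes "x \<in> corner v w m" "w \<in> verts G" shows "x * vx w = x"
  using assms(1) unfolding corner_def
proof induction
  case (add b x)
  then show ?case using monomial_vx assms(2) by (auto simp: monomials_def distrib_right)
qed simp

text \<open>The outer vertices keep the monomials from \<open>v\<close> to \<open>w\<close> and kill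
  the others. Finitely many monomials have a common bound on their ghost lengths.\<close>

lemma vx_span_vx_in_corner:
  assumes "x \<in> leavitt_span" "v \<in> verts G" "w \<in> verts G"
  shows "\<exists>m. vx v * x * vx w \<in> corner v w m"
  using assms(1) unfolding leavitt_span_def
proof induction
  case zero
  then show ?case by (auto simp: corner_def intro: additive_span.zero)
next
  case (add b x)
  then obtain m where m: "vx v * x * vx w \<in> corner v w m" by blast
  obtain v' w' c p u q where b: "awalk v' p u" "awalk w' q u" "b = sc c * (rp p u * gp q u)"
    using add.hyps(1) by (auto simp: monomials_def)
  define n where "n = m + Suc (length q)"
  have "vx v * b * vx w = b \<and> v = v' \<and> w = w' \<or> vx v * b * vx w = 0"
    using vx_monomial[OF b(1,2) assms(2)] monomial_vx[OF b(1,2) assms(3)] by (auto simp: b(3))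
  moreover have "b \<in> monomials v' w' n"
    unfolding b(3) n_def using b by (intro monomialsI) auto
  ultimately have "vx v * b * vx w \<in> corner v w n"
    by (auto simp: corner_def intro: additive_span.zero additive_span_base)
  moreover have "vx v * x * vx w \<in> corner v w n"
    using m by (rule corner_mono) (simp add: n_def)
  ultimately show ?case
    unfolding corner_def by (auto simp: distrib_left distrib_right intro!: exI[of _ n] additive_span_plus)
qed

text \<open>A monomial in the corner consists of two paths, from \<open>v\<close> and from
  \<open>w\<close>, with a common end. Without such paths the corner is zero.\<close>

lemma vx_span_vx_disconnected:
  assumes "x \<in> leavitt_span" "v \<in> verts G" "w \<in> verts G"
    and "vx v * x * vx w \<noteq> 0"
  shows "\<exists>p q u. awalk v p u \<and> awalk w q u"
proof (rule ccontr)
  assume "\<not> ?thesis"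
  then have "monomials v w m = {}" for m by (auto simp: monomials_def)
  then have "vx v * x * vx w = 0"
    using vx_span_vx_in_corner[OF assms(1-3)] additive_span_empty by (auto simp: corner_def)
  with assms(4) show False by simp
qed

section \<open>Extraction of a vertex from a nonzero element\<close>

lemma corner_decompose:
  assumes "z \<in> corner v u (Suc m)"
  shows "\<exists>S c F y. finite S \<and> (\<forall>p\<in>S. awalk v p u) \<and> (\<forall>p. p \<notin> S \<longrightarrow> c p = 0) \<and>
    finite F \<and> F \<subseteq> out_arcs G u \<and> (\<forall>f. f \<notin> F \<longrightarrow> y f = 0) \<and>
    (\<forall>f. y f \<in> corner v (head G f) m) \<and>
    z = (\<Sum>p\<in>S. sc (c p) * rp p u) + (\<Sum>f\<in>F. y f * gh f)"
  using assms unfolding corner_def[of _ _ "Suc m"]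
proof induction
  case zero
  have "0 \<in> corner v (head G f) m" for f by (simp add: corner_def additive_span.zero)
  then show ?case by (intro exI[of _ "{}"] exI[of _ "\<lambda>_. 0"]) auto
next
  case (add b z)
  then obtain S c F y where IH: "finite S" "\<forall>p\<in>S. awalk v p u" "\<forall>p. p \<notin> S \<longrightarrow> c p = 0"
    "finite F" "F \<subseteq> out_arcs G u" "\<forall>f. f \<notin> F \<longrightarrow> y f = 0" "\<forall>f. y f \<in> corner v (head G f) m"
    "z = (\<Sum>p\<in>S. sc (c p) * rp p u) + (\<Sum>f\<in>F. y f * gh f)"
    by (elim exE conjE) (rule that)
  obtain d p x q where b: "awalk v p x" "awalk u q x" "length q < Suc m"
    "b = sc d * (rp p x * gp q x)"
    using add.hyps(1) by (auto simp: monomials_def)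
  show ?case
  \<comment> \<open>With an empty ghost path the monomial joins the real combination. A ghost path
    \<open>g # r\<close> has \<open>gh g\<close> as its rightmost factor; splitting it off leaves
    the shorter ghost path \<open>r\<close>, which explains the bound \<open>m\<close> for
    \<open>y\<close>.\<close>
  proof (cases q)
    case Nil
    then have [simp]: "x = u" and u: "u \<in> verts G" using b(2) by (auto simp: awalk_Nil_iff)
    have b': "b = sc d * rp p u" using b rp_vx[OF b(1)] Nil u by simp
    define f where "f = (\<lambda>p. sc (c p) * rp p u)"
    have "(\<Sum>p'\<in>insert p S. sc ((c(p := c p + d)) p') * rp p' u) = (\<Sum>p'\<in>insert p S. (f(p := f p + b)) p')"
      by (rule sum.cong) (auto simp: f_def b' sc_add distrib_right)
    also have "\<dots> = (\<Sum>p\<in>S. sc (c p) * rp p u) + b"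
      using IH(1,3) by (subst sum_fun_upd_plus) (auto simp: f_def sc_zero)
    finally have "b + z = (\<Sum>p'\<in>insert p S. sc ((c(p := c p + d)) p') * rp p' u) + (\<Sum>f\<in>F. y f * gh f)"
      unfolding IH(8) by (simp only: ac_simps)
    then show ?thesis
      using IH(1-7) b(1)
      by (intro exI[of _ "insert p S"] exI[of _ "c(p := c p + d)"] exI[of _ F] exI[of _ y]) auto
  next
    case (Cons g r)
    then have g: "g \<in> arcs G" "tail G g = u" "awalk (head G g) r x"
      using b(2) by (auto simp: awalk_Cons_iff)
    define a where "a = sc d * (rp p x * gp r x)"
    have a: "a \<in> corner v (head G g) m" unfolding a_def corner_def
      using b(1,3) g(3) Cons by (auto intro!: additive_span_base monomialsI)
    have b': "b = a * gh g" by (simp add: b(4) a_def Cons mult.assoc)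
    define f where "f = (\<lambda>g. y g * gh g)"
    have "(\<Sum>h\<in>insert g F. (y(g := y g + a)) h * gh h) = (\<Sum>h\<in>insert g F. (f(g := f g + b)) h)"
      by (rule sum.cong) (auto simp: f_def b' distrib_right)
    also have "\<dots> = (\<Sum>h\<in>F. y h * gh h) + b"
      using IH(4,6) by (subst sum_fun_upd_plus) (auto simp: f_def)
    finally have "b + z = (\<Sum>p\<in>S. sc (c p) * rp p u) + (\<Sum>h\<in>insert g F. (y(g := y g + a)) h * gh h)"
      unfolding IH(8) by (simp only: ac_simps)
    moreover have "y g + a \<in> corner v (head G g) m"
      using IH(7) a unfolding corner_def by (blast intro: additive_span_plus)
    ultimately show ?thesis
      using IH(1-7) g
      by (intro exI[of _ S] exI[of _ c] exI[of _ "insert g F"] exI[of _ "y(g := y g + a)"])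
        (auto simp: out_arcs_def)
  qed
qed

text \<open>Dividing by a shortest path \<open>p0\<close> and conjugating by \<open>t\<close> are
  done at once: the left factor is the adjoint of \<open>p0 @ t\<close> scaled by the inverse of
  \<open>c p0\<close>, the right factor is \<open>rp t u\<close>. Only the term of \<open>p0\<close>
  survives.\<close>

lemma real_combination_to_vertex:
  assumes "recurrent u" "finite S" "S \<noteq> {}"
    and S: "\<And>p. p \<in> S \<Longrightarrow> awalk v p u" and c: "\<And>p. p \<in> S \<Longrightarrow> c p \<noteq> 0"
  shows "\<exists>a\<in>leavitt_span. \<exists>b\<in>leavitt_span. a * (\<Sum>p\<in>S. sc (c p) * rp p u) * b = vx u"
proof -
  obtain p0 where p0: "p0 \<in> S" "\<And>p. p \<in> S \<Longrightarrow> length p0 \<le> length p"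
    using ex_has_least_nat[of "\<lambda>p. p \<in> S" _ length] assms(3) by (metis all_not_in_conv)
  \<comment> \<open>These are the nontrivial closed paths at \<open>u\<close> left over when
    \<open>p0\<close> is removed from the paths extending it. The path \<open>t\<close> is chosen so
    as to kill them.\<close>
  define T where "T = {g. g \<noteq> [] \<and> p0 @ g \<in> S}"
  have "T \<subseteq> drop (length p0) ` S" by (force simp: T_def)
  then have "finite T" using assms(2) finite_subset by blast
  then obtain t where t: "awalk u t u" "\<And>g. g \<in> T \<Longrightarrow> \<not> prefix t (g @ t)"
    using recurrent_avoids_powers[OF assms(1), of T] by (auto simp: T_def)
  have w: "awalk v (p @ t) u" if "p \<in> S" for p using S that t(1) awalk_appendI by blast
  have vanish: "gp (p0 @ t) u * rp (p @ t) u = 0" if p: "p \<in> S" "p \<noteq> p0" for p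
  proof (rule gp_rp_incomparable[OF w[OF p0(1)] w[OF p(1)]])
    show "\<not> prefix (p0 @ t) (p @ t)"
    proof
      assume pre: "prefix (p0 @ t) (p @ t)"
      then have "prefix p0 p"
        using p0(2)[OF p(1)] by (metis append_prefixD prefix_length_prefix prefixI)
      then obtain g where g: "p = p0 @ g" by (auto simp: prefix_def)
      with p have "g \<in> T" by (auto simp: T_def)
      then show False using t(2) pre g by auto
    qed
    \<comment> \<open>Here minimality of \<open>p0\<close> forces equal lengths, and then
      \<open>p = p0\<close>.\<close>
    show "\<not> prefix (p @ t) (p0 @ t)"
    proof
      assume pre: "prefix (p @ t) (p0 @ t)"
      then have "length p = length p0" using prefix_length_le[OF pre] p0(2)[OF p(1)] by auto
      with pre p(2) show False by (auto simp: prefix_def)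
    qed
  qed
  define a where "a = sc (1 / c p0) * gp (p0 @ t) u"
  have "a * (sc (c p) * rp p u) * rp t u = (if p = p0 then vx u else 0)" if p: "p \<in> S" for p
  proof -
    have "a * (sc (c p) * rp p u) * rp t u
        = sc (1 / c p0) * (gp (p0 @ t) u * sc (c p)) * (rp p u * rp t u)"
      by (simp add: a_def mult.assoc)
    also have "\<dots> = sc (1 / c p0) * sc (c p) * (gp (p0 @ t) u * rp (p @ t) u)"
      by (simp add: sc_gp[OF w[OF p0(1)]] rp_append[OF S[OF p] t(1)] mult.assoc)
    finally show ?thesis
      using vanish[OF p] gp_rp_same[OF w[OF p0(1)]] c[OF p0(1)] sc_one recurrent_in_verts[OF assms(1)]
      by (auto simp: sc_mult[symmetric])
  qed
  then have "a * (\<Sum>p\<in>S. sc (c p) * rp p u) * rp t u = vx u"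
    using p0(1) assms(2) by (simp add: sum_distrib_left sum_distrib_right)
  moreover have "a \<in> leavitt_span" "rp t u \<in> leavitt_span"
    unfolding a_def using gp_in_span(1) rp_in_span(2) w p0(1) t(1) by blast+
  ultimately show ?thesis by blast
qed

text \<open>Multiplying by an edge \<open>f\<close> leaving \<open>u\<close> shortens the ghost
  paths and moves the end vertex to \<open>head G f\<close>, which is again recurrent. The induction
  therefore runs over all recurrent \<open>u\<close>.\<close>

lemma corner_to_vertex:
  assumes "recurrent u" "z \<in> corner v u m" "z \<noteq> 0"
  shows "\<exists>a\<in>leavitt_span. \<exists>b\<in>leavitt_span. a * z * b = vx u"
  using assms
proof (induction m arbitrary: u z)
  case 0
  then show ?case using corner_0 by blast
next
  case (Suc m)
  obtain S0 c F y where dec: "finite S0" "\<forall>p\<in>S0. awalk v p u" "\<forall>p. p \<notin> S0 \<longrightarrow> c p = 0"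
    "finite F" "F \<subseteq> out_arcs G u" "\<forall>f. f \<notin> F \<longrightarrow> y f = 0" "\<forall>f. y f \<in> corner v (head G f) m"
    "z = (\<Sum>p\<in>S0. sc (c p) * rp p u) + (\<Sum>f\<in>F. y f * gh f)"
    using corner_decompose[OF Suc.prems(2)] by (elim exE conjE) (rule that)
  define S where "S = {p \<in> S0. c p \<noteq> 0}"
  have S: "finite S" "\<And>p. p \<in> S \<Longrightarrow> awalk v p u" "\<And>p. p \<in> S \<Longrightarrow> c p \<noteq> 0"
    using dec by (auto simp: S_def)
  have "(\<Sum>p\<in>S0. sc (c p) * rp p u) = (\<Sum>p\<in>S. sc (c p) * rp p u)"
    using dec(1) by (intro sum.mono_neutral_right) (auto simp: S_def sc_zero)
  then have z: "z = (\<Sum>p\<in>S. sc (c p) * rp p u) + (\<Sum>f\<in>F. y f * gh f)"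
    using dec(8) by simp
  have u: "u \<in> verts G" using Suc.prems(1) recurrent_in_verts by blast
  have arc: "f \<in> arcs G" "tail G f = u" "awalk u [f] (head G f)" "recurrent (head G f)"
    if "f \<in> out_arcs G u" for f
  proof -
    show f: "f \<in> arcs G" "tail G f = u" using that by (auto simp: out_arcs_def)
    then show "awalk u [f] (head G f)" by (auto simp: awalk_simps)
    then show "recurrent (head G f)" using recurrent_hereditary Suc.prems(1) by blast
  qed
  \<comment> \<open>Multiplication by \<open>ed f\<close> extends every real path by
    \<open>f\<close> and picks out the coefficient \<open>y f\<close> of the ghost part.\<close>
  have zf: "z * ed f = (\<Sum>p\<in>S. sc (c p) * rp (p @ [f]) (head G f)) + y f"
    if f: "f \<in> out_arcs G u" for f
  proof -
    note f' = arc[OF f]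
    have "rp p u * ed f = rp (p @ [f]) (head G f)" if "p \<in> S" for p
      using rp_append[OF S(2)[OF that] f'(3)] f'(1) by (simp add: ed_head)
    then have "(\<Sum>p\<in>S. sc (c p) * rp p u) * ed f = (\<Sum>p\<in>S. sc (c p) * rp (p @ [f]) (head G f))"
      by (simp add: sum_distrib_right mult.assoc)
    moreover have "(\<Sum>g\<in>F. y g * gh g) * ed f = y f"
    proof -
      have "(\<Sum>g\<in>F. y g * gh g) * ed f = (\<Sum>g\<in>F. y g * (gh g * ed f))"
        by (simp add: sum_distrib_right mult.assoc)
      also have "\<dots> = (\<Sum>g\<in>F. if g = f then y f * vx (head G f) else 0)"
        using dec(5) f' by (intro sum.cong) (auto simp: gh_ed out_arcs_def)
      also have "\<dots> = y f"
        using dec(4,6,7) f' corner_vx[of "y f" v "head G f" m] by auto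
      finally show ?thesis .
    qed
    ultimately show ?thesis by (simp add: z distrib_right)
  qed
  \<comment> \<open>A vertex extracted at \<open>head G f\<close> is carried to \<open>u\<close> by
    conjugation with a path leading back to \<open>u\<close>.\<close>
  have return: ?case if f: "f \<in> out_arcs G u"
    and ab: "a \<in> leavitt_span" "b \<in> leavitt_span" "a * (z * ed f) * b = vx (head G f)" for f a b
  proof -
    obtain q where q: "awalk (head G f) q u" using recurrent_returns Suc.prems(1) arc(3)[OF f] by blast
    have h: "head G f \<in> verts G" using q by blast
    have "(gp q u * a) * z * (ed f * b * rp q u) = (gp q u * (a * (z * ed f) * b)) * rp q u"
      by (simp add: mult.assoc)
    also have "\<dots> = vx u" by (simp add: ab(3) gp_vx[OF q h] gp_rp_same[OF q])
    finally show ?thesis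
      using ab q f by (intro bexI[of _ "gp q u * a"] bexI[of _ "ed f * b * rp q u"])
        (auto intro!: span_mult ed_in_span rp_in_span(2) gp_in_span(2) arc(1))
  qed
  \<comment> \<open>Either there is no real part, or no ghost part, or some edge leaving
    \<open>u\<close> misses all ghost terms, or all edges leaving \<open>u\<close> occur in them. In
    the last case \<open>u\<close> emits only finitely many edges.\<close>
  consider "S = {}" | "S \<noteq> {}" "m = 0" | f where "S \<noteq> {}" "f \<in> out_arcs G u" "f \<notin> F"
    | "S \<noteq> {}" "0 < m" "out_arcs G u \<subseteq> F" by blast
  then show ?case
  proof cases
    case 1
    then obtain f where f: "f \<in> F" "y f \<noteq> 0"
      using Suc.prems(3) z by (metis (no_types, lifting) add_0 mult_zero_left sum.empty sum.neutral)
    then have fu: "f \<in> out_arcs G u" using dec(5) by blast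
    then have "z * ed f \<in> corner v (head G f) m" "z * ed f \<noteq> 0"
      using zf f dec(7) 1 by auto
    then show ?thesis using Suc.IH[OF arc(4)[OF fu]] return[OF fu] by blast
  next
    case 2
    then have "y f = 0" for f using dec(7) corner_0 by blast
    then have "z = (\<Sum>p\<in>S. sc (c p) * rp p u)" using z by simp
    then show ?thesis
      using real_combination_to_vertex[OF Suc.prems(1) S(1) 2(1) S(2,3)] by simp
  next
    case 3
    \<comment> \<open>Appending \<open>f\<close> is injective, so no two terms merge and all
      coefficients stay nonzero.\<close>
    define S' where "S' = (\<lambda>p. p @ [f]) ` S"
    have "z * ed f = (\<Sum>p\<in>S'. sc (c (butlast p)) * rp p (head G f))"
      using zf[OF 3(2)] dec(6) 3(3) unfolding S'_def by (subst sum.reindex) (auto simp: inj_on_def)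
    moreover have "\<exists>a\<in>leavitt_span. \<exists>b\<in>leavitt_span.
        a * (\<Sum>p\<in>S'. sc (c (butlast p)) * rp p (head G f)) * b = vx (head G f)"
    proof (rule real_combination_to_vertex)
      show "recurrent (head G f)" by (rule arc(4)[OF 3(2)])
      show "finite S'" "S' \<noteq> {}" using S(1) 3(1) by (auto simp: S'_def)
      show "awalk v p (head G f)" if "p \<in> S'" for p
        using that S(2) arc(3)[OF 3(2)] awalk_appendI unfolding S'_def by blast
      show "c (butlast p) \<noteq> 0" if "p \<in> S'" for p
        using that S(3) by (auto simp: S'_def)
    qed
    ultimately show ?thesis using return[OF 3(2)] by metis
  next
    case 4
    then have "regular_vertex u"
      using u recurrent_not_sink[OF Suc.prems(1)] dec(4) finite_subset unfolding regular_vertex_def by blast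
    \<comment> \<open>The second Cuntz-Krieger relation recovers \<open>z\<close> from the products
      \<open>z * ed f\<close>, so one of them is nonzero.\<close>
    then have "z = z * (\<Sum>f\<in>out_arcs G u. ed f * gh f)"
      using corner_vx[OF Suc.prems(2) u] vx_regular by simp
    then have "z = (\<Sum>f\<in>out_arcs G u. (z * ed f) * gh f)"
      by (simp add: sum_distrib_left mult.assoc)
    then obtain f where f: "f \<in> out_arcs G u" "z * ed f \<noteq> 0"
      using Suc.prems(3) by (metis (no_types, lifting) mult_zero_left sum.neutral)
    \<comment> \<open>A real path has ghost length \<open>0\<close>, which is below the bound
      because \<open>0 < m\<close>. This is why \<open>m = 0\<close> is treated apart.\<close>
    have "sc (c p) * rp (p @ [f]) (head G f) \<in> corner v (head G f) m" if "p \<in> S" for p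
    proof -
      have w: "awalk v (p @ [f]) (head G f)" using S(2)[OF that] arc(3)[OF f(1)] awalk_appendI by blast
      then have h: "head G f \<in> verts G" by blast
      have "sc (c p) * (rp (p @ [f]) (head G f) * gp [] (head G f)) \<in> monomials v (head G f) m"
        using w h 4(2) by (intro monomialsI) (auto simp: awalk_Nil_iff)
      then show ?thesis
        using rp_vx[OF w h] unfolding corner_def by (auto intro: additive_span_base)
    qed
    then have "z * ed f \<in> corner v (head G f) m"
      unfolding zf[OF f(1)] using dec(7) unfolding corner_def
      by (intro additive_span_plus additive_span_sum) auto
    then show ?thesis using Suc.IH[OF arc(4)[OF f(1)] _ f(2)] return[OF f(1)] by blast
  qed
qed

section \<open>Factorisation in ideals generated by vertices\<close>

definition vertex_ideal :: "'a set \<Rightarrow> 'r set" where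
  "vertex_ideal X = additive_span {x * vx v * y |x v y. x \<in> leavitt_span \<and> v \<in> X \<and> y \<in> leavitt_span}"

lemma vertex_ideal_base:
  "\<lbrakk>x \<in> leavitt_span; v \<in> X; y \<in> leavitt_span\<rbrakk> \<Longrightarrow> x * vx v * y \<in> vertex_ideal X"
  unfolding vertex_ideal_def by (intro additive_span_base) blast

text \<open>In a product of generators around \<open>a\<close>, the middle part
  \<open>vx v * (x' * a * y) * vx w\<close> is either zero or a nonzero corner element. In the
  second case \<open>vx w\<close> can be extracted from it, hence from \<open>a\<close>, and the
  whole product lies in the ideal of such vertices \<open>w\<close>.\<close>

lemma vertex_ideal_to_vertices:
  assumes X: "\<And>v. v \<in> X \<Longrightarrow> recurrent v" and a: "a \<in> leavitt_span"
    and x: "x \<in> vertex_ideal X" and y: "y \<in> vertex_ideal X"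
  shows "x * a * y \<in> vertex_ideal {v \<in> X. \<exists>p\<in>leavitt_span. \<exists>q\<in>leavitt_span. p * a * q = vx v}"
    (is "_ \<in> vertex_ideal ?Y")
proof -
  have base: "(x * vx v * x') * a * (y * vx w * y') \<in> vertex_ideal ?Y"
    if "x \<in> leavitt_span" "x' \<in> leavitt_span" "v \<in> X" "y \<in> leavitt_span" "y' \<in> leavitt_span" "w \<in> X"
    for x x' v y y' w
  proof (cases "vx v * (x' * a * y) * vx w = 0")
    case True
    have "(x * vx v * x') * a * (y * vx w * y') = x * (vx v * (x' * a * y) * vx w) * y'"
      by (simp add: mult.assoc)
    then show ?thesis unfolding True by (simp add: vertex_ideal_def additive_span.zero)
  next
    case False
    have vw: "v \<in> verts G" "w \<in> verts G" using that X recurrent_in_verts by blast+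
    have t: "x' * a * y \<in> leavitt_span" using that a by (intro span_mult)
    obtain m where "vx v * (x' * a * y) * vx w \<in> corner v w m"
      using vx_span_vx_in_corner[OF t vw] by blast
    then obtain p q where pq: "p \<in> leavitt_span" "q \<in> leavitt_span"
      "p * (vx v * (x' * a * y) * vx w) * q = vx w"
      using corner_to_vertex[OF X[OF \<open>w \<in> X\<close>]] False by blast
    then have "(p * vx v * x') * a * (y * vx w * q) = vx w" by (simp add: mult.assoc)
    moreover have "p * vx v * x' \<in> leavitt_span" "y * vx w * q \<in> leavitt_span"
      using pq that vw by (auto intro!: span_mult vx_in_span)
    ultimately have "w \<in> ?Y" using \<open>w \<in> X\<close> by blast
    moreover have "x * vx v * x' * a * y \<in> leavitt_span"
      using a that vw by (auto intro!: span_mult vx_in_span)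
    ultimately have "(x * vx v * x' * a * y) * vx w * y' \<in> vertex_ideal ?Y"
      using that by (intro vertex_ideal_base)
    then show ?thesis by (simp add: mult.assoc)
  qed
  have "x * (a * y) \<in> additive_span {x * vx v * y |x v y. x \<in> leavitt_span \<and> v \<in> ?Y \<and> y \<in> leavitt_span}"
  proof (rule additive_span_mult_right[OF _ x[unfolded vertex_ideal_def]])
    fix b assume b: "b \<in> {x * vx v * y |x v y. x \<in> leavitt_span \<and> v \<in> X \<and> y \<in> leavitt_span}"
    have "b * a * y \<in> additive_span {x * vx v * y |x v y. x \<in> leavitt_span \<and> v \<in> ?Y \<and> y \<in> leavitt_span}"
    proof (rule additive_span_mult_left[OF _ y[unfolded vertex_ideal_def]])
      fix d assume "d \<in> {x * vx v * y |x v y. x \<in> leavitt_span \<and> v \<in> X \<and> y \<in> leavitt_span}"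
      then show "b * a * d \<in> additive_span {x * vx v * y |x v y. x \<in> leavitt_span \<and> v \<in> ?Y \<and> y \<in> leavitt_span}"
        using b base unfolding vertex_ideal_def[symmetric] by blast
    qed
    then show "b * (a * y) \<in> additive_span {x * vx v * y |x v y. x \<in> leavitt_span \<and> v \<in> ?Y \<and> y \<in> leavitt_span}"
      by (simp add: mult.assoc)
  qed
  then show ?thesis unfolding vertex_ideal_def by (simp add: mult.assoc)
qed

text \<open>On recurrent vertices reachability is symmetric, and \<open>C u\<close> is the component
  of \<open>u\<close> within \<open>Y\<close>. The choice depends on \<open>u\<close> only through
  the set \<open>C u\<close>, so it is constant on components. Representatives that reach a common
  vertex lie in one component.\<close>

lemma recurrent_representatives:
  assumes "\<And>v. v \<in> Y \<Longrightarrow> recurrent v"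
  obtains r where "\<And>u. u \<in> Y \<Longrightarrow> r u \<in> Y" and "\<And>u. u \<in> Y \<Longrightarrow> \<exists>p. awalk (r u) p u"
    and "\<And>u v p q w. \<lbrakk>u \<in> Y; v \<in> Y; awalk (r u) p w; awalk (r v) q w\<rbrakk> \<Longrightarrow> r u = r v"
proof -
  define C where "C u = {v \<in> Y. \<exists>p. awalk u p v}" for u
  define r where "r u = (SOME v. v \<in> C u)" for u
  have r: "r u \<in> C u" if "u \<in> Y" for u
  proof -
    have "u \<in> C u" unfolding C_def
      using that assms recurrent_in_verts awalk_Nil_iff by blast
    then show ?thesis unfolding r_def by (rule someI)
  qed
  have C_sub: "C v \<subseteq> C u" if "\<exists>p. awalk u p v" for u v
    using that awalk_appendI unfolding C_def by blast
  have return: "\<exists>p. awalk (r u) p u" if "u \<in> Y" for u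
    using r[OF that] recurrent_returns assms that unfolding C_def by blast
  have "r u = r v" if uv: "u \<in> Y" "v \<in> Y" and w: "awalk (r u) p w" "awalk (r v) q w" for u v p q w
  proof -
    have to_w: "\<exists>s. awalk x s w" if "x \<in> Y" "\<exists>s. awalk (r x) s w" for x
      using r[OF that(1)] that(2) awalk_appendI unfolding C_def by blast
    have from_w: "\<exists>s. awalk w s x" if "x \<in> Y" "\<exists>s. awalk (r x) s w" for x
      using to_w[OF that] recurrent_returns[OF assms[OF that(1)]] by blast
    have "\<exists>s. awalk u s v" "\<exists>s. awalk v s u"
      using to_w from_w uv w awalk_appendI by meson+
    then have "C u = C v" using C_sub by blast
    then show ?thesis by (simp add: r_def)
  qed
  then show thesis using that[of r] r return unfolding C_def by blast
qed

text \<open>Each summand of \<open>b\<close> gets its own path \<open>t i\<close>, and orthogonality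
  of these paths reduces the double sum \<open>x * a * y\<close> to its diagonal. The multipliers
  \<open>P\<close> and \<open>Q\<close> are taken at the representative, so that equal
  representatives give the same middle factor, a vertex.\<close>

lemma vertex_ideal_factor:
  assumes Y: "\<And>v. v \<in> Y \<Longrightarrow> recurrent v" "\<And>v. v \<in> Y \<Longrightarrow> \<exists>p\<in>leavitt_span. \<exists>q\<in>leavitt_span. p * a * q = vx v"
    and a: "a \<in> leavitt_span" and b: "b \<in> vertex_ideal Y"
  shows "\<exists>x\<in>vertex_ideal Y. \<exists>y\<in>vertex_ideal Y. b = x * a * y"
proof -
  obtain n :: nat and f where f: "\<And>i. i < n \<Longrightarrow> f i \<in> {x * vx v * y |x v y. x \<in> leavitt_span \<and> v \<in> Y \<and> y \<in> leavitt_span}"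
    and bf: "b = (\<Sum>i<n. f i)"
    using additive_span_sumE[OF b[unfolded vertex_ideal_def]] by blast
  have "\<forall>i. \<exists>x v y. i < n \<longrightarrow> f i = x * vx v * y \<and> x \<in> leavitt_span \<and> v \<in> Y \<and> y \<in> leavitt_span"
    using f by blast
  then obtain A U B where AUB: "\<And>i. i < n \<Longrightarrow> f i = A i * vx (U i) * B i"
    "\<And>i. i < n \<Longrightarrow> A i \<in> leavitt_span" "\<And>i. i < n \<Longrightarrow> U i \<in> Y" "\<And>i. i < n \<Longrightarrow> B i \<in> leavitt_span"
    by metis
  obtain r where r: "\<And>u. u \<in> Y \<Longrightarrow> r u \<in> Y" "\<And>u. u \<in> Y \<Longrightarrow> \<exists>p. awalk (r u) p u"
    "\<And>u v p q w. \<lbrakk>u \<in> Y; v \<in> Y; awalk (r u) p w; awalk (r v) q w\<rbrakk> \<Longrightarrow> r u = r v"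
    using recurrent_representatives[OF Y(1)] by metis
  obtain P Q where PQ: "\<And>v. v \<in> Y \<Longrightarrow> P v \<in> leavitt_span" "\<And>v. v \<in> Y \<Longrightarrow> Q v \<in> leavitt_span"
    "\<And>v. v \<in> Y \<Longrightarrow> P v * a * Q v = vx v"
    using Y(2) by metis
  obtain T :: "'a \<Rightarrow> nat \<Rightarrow> 'b list" where T: "\<And>v k. v \<in> Y \<Longrightarrow> awalk v (T v k) v"
    "\<And>v i j. v \<in> Y \<Longrightarrow> i \<noteq> j \<Longrightarrow> \<not> prefix (T v i) (T v j)"
    using recurrent_incomparable_family[OF Y(1)] by metis
  obtain s where s: "\<And>u. u \<in> Y \<Longrightarrow> awalk (r u) (s u) u" using r(2) by metis
  define V where "V i = r (U i)" for i
  \<comment> \<open>Using the index \<open>i\<close> itself makes the paths from a common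
    representative pairwise incomparable, even when the vertices \<open>U i\<close> repeat. The tail
    \<open>s (U i)\<close> leads from the representative to \<open>U i\<close>.\<close>
  define t where "t i = T (V i) i @ s (U i)" for i
  have V: "V i \<in> Y" if "i < n" for i using r(1) AUB(3) that by (simp add: V_def)
  have t: "awalk (V i) (t i) (U i)" if "i < n" for i
    using awalk_appendI[OF T(1)[OF V[OF that]] s[OF AUB(3)[OF that], folded V_def]] by (simp add: t_def)
  have verts: "V i \<in> verts G" "U i \<in> verts G" if "i < n" for i using t[OF that] by blast+
  \<comment> \<open>The factor \<open>vx (U i)\<close> keeps each summand visibly in the ideal of
    \<open>Y\<close>; so does \<open>vx (U j)\<close> in \<open>y\<close>.\<close>
  define x where "x = (\<Sum>i<n. A i * vx (U i) * (gp (t i) (U i) * P (V i)))"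
  define y where "y = (\<Sum>j<n. (Q (V j) * rp (t j) (U j)) * vx (U j) * B j)"
  have "x \<in> vertex_ideal Y" unfolding x_def vertex_ideal_def
  proof (intro additive_span_sum, fold vertex_ideal_def)
    fix i assume "i \<in> {..<n}"
    then show "A i * vx (U i) * (gp (t i) (U i) * P (V i)) \<in> vertex_ideal Y"
      using AUB V gp_in_span(2)[OF t] PQ by (intro vertex_ideal_base span_mult) auto
  qed
  moreover have "y \<in> vertex_ideal Y" unfolding y_def vertex_ideal_def
  proof (intro additive_span_sum, fold vertex_ideal_def)
    fix i assume "i \<in> {..<n}"
    then show "(Q (V i) * rp (t i) (U i)) * vx (U i) * B i \<in> vertex_ideal Y"
      using AUB V rp_in_span(2)[OF t] PQ by (intro vertex_ideal_base span_mult) auto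
  qed
  moreover have "b = x * a * y"
  proof -
    have prod_term: "A i * vx (U i) * (gp (t i) (U i) * P (V i)) * a * (Q (V j) * rp (t j) (U j) * vx (U j) * B j)
        = (if i = j then f i else 0)" (is "?l = _") if ij: "i < n" "j < n" for i j
    proof -
      let ?m = "P (V i) * a * Q (V j)"
      have gi: "gp (t i) (U i) * vx (V i) = gp (t i) (U i)" using gp_vx[OF t verts(1)] ij by simp
      have rj: "vx (V j) * rp (t j) (U j) = rp (t j) (U j)" using vx_rp[OF t verts(1)] ij by simp
      have l: "?l = A i * vx (U i) * (gp (t i) (U i) * ?m * rp (t j) (U j)) * (vx (U j) * B j)"
        by (simp add: mult.assoc)
      show ?thesis
      proof (cases "V i = V j")
        case True
        then have m: "?m = vx (V i)" using PQ(3)[OF V[OF ij(1)]] by simp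
        show ?thesis
        proof (cases "i = j")
          case True
          have "gp (t i) (U i) * ?m * rp (t j) (U j) = vx (U i)"
            using gp_rp_same[OF t[OF ij(1)]] True m gi by simp
          then have "?l = A i * (vx (U i) * vx (U i) * vx (U i)) * B i"
            unfolding l using True by (simp add: mult.assoc)
          then show ?thesis using True AUB(1)[OF ij(1)] verts(2)[OF ij(1)] by (simp add: vx_vx)
        next
          case False
          have "\<not> prefix (T (V i) i) (T (V j) j)" "\<not> prefix (T (V j) j) (T (V i) i)"
            using T(2) V ij False True by metis+
          then have "\<not> prefix (t i) (t j)" "\<not> prefix (t j) (t i)"
            unfolding t_def by (metis append_prefixD prefix_same_cases prefixI)+
          then have "gp (t i) (U i) * rp (t j) (U j) = 0"
            using gp_rp_incomparable t ij by blast
          then show ?thesis unfolding l m gi using False by simp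
        qed
      next
        case False
        \<comment> \<open>Different representatives reach no common vertex, so the corner between
          them is zero.\<close>
        have "?m \<in> leavitt_span" using PQ V a ij by (intro span_mult) auto
        then have "vx (V i) * ?m * vx (V j) = 0"
          using vx_span_vx_disconnected[OF _ verts(1)[OF ij(1)] verts(1)[OF ij(2)]] False
            r(3)[OF AUB(3)[OF ij(1)] AUB(3)[OF ij(2)]] unfolding V_def by blast
        moreover have "gp (t i) (U i) * (vx (V i) * ?m * vx (V j)) * rp (t j) (U j)
            = (gp (t i) (U i) * vx (V i)) * ?m * (vx (V j) * rp (t j) (U j))"
          by (simp only: mult.assoc)
        ultimately have "gp (t i) (U i) * ?m * rp (t j) (U j) = 0" by (simp add: gi rj)
        then show ?thesis unfolding l using False by auto
      qed
    qed
    have "x * a * y = (\<Sum>i<n. \<Sum>j<n. if i = j then f i else 0)"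
      unfolding x_def y_def sum_distrib_right sum_distrib_left
      by (subst sum.swap) (intro sum.cong refl, simp only: prod_term lessThan_iff)
    then show ?thesis by (simp add: bf)
  qed
  ultimately show ?thesis by blast
qed

definition multiples_in :: "'r set \<Rightarrow> 'r \<Rightarrow> 'r set" where
  "multiples_in J a = additive_span {x * a * y |x y. x \<in> J \<and> y \<in> J}"

lemma vertex_ideal_subset: "Y \<subseteq> X \<Longrightarrow> vertex_ideal Y \<subseteq> vertex_ideal X"
  unfolding vertex_ideal_def by (intro subsetI, erule additive_span_subset[rotated]) (blast intro: additive_span_base)

text \<open>The element \<open>b\<close> already lies in the ideal of those vertices of
  \<open>X\<close> that can be extracted from \<open>a\<close>, and there the factorisation
  applies.\<close>

lemma vertex_ideal_properly_infinite:
  assumes X: "\<And>v. v \<in> X \<Longrightarrow> recurrent v" and a: "a \<in> leavitt_span"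
    and b: "b \<in> multiples_in (vertex_ideal X) a"
  shows "\<exists>x\<in>vertex_ideal X. \<exists>y\<in>vertex_ideal X. b = x * a * y"
proof -
  define Y where "Y = {v \<in> X. \<exists>p\<in>leavitt_span. \<exists>q\<in>leavitt_span. p * a * q = vx v}"
  have "b \<in> vertex_ideal Y"
    using b vertex_ideal_to_vertices[OF X a] unfolding multiples_in_def vertex_ideal_def[of Y]
    by (elim additive_span_subset[rotated]) (auto simp: Y_def vertex_ideal_def)
  moreover have "recurrent v" "\<exists>p\<in>leavitt_span. \<exists>q\<in>leavitt_span. p * a * q = vx v" if "v \<in> Y" for v
    using that X by (simp_all add: Y_def)
  ultimately obtain x y where "x \<in> vertex_ideal Y" "y \<in> vertex_ideal Y" "b = x * a * y"
    using vertex_ideal_factor[OF _ _ a] by blast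
  moreover have "vertex_ideal Y \<subseteq> vertex_ideal X" by (rule vertex_ideal_subset) (auto simp: Y_def)
  ultimately show ?thesis by blast
qed

text \<open>Two incomparable closed paths and their adjoints. If \<open>v\<close> lies outside an
  ideal, then so do \<open>g'\<close> and \<open>h\<close>, although their product is zero. The last
  four equations show that all four elements lie in every ideal containing \<open>v\<close>.\<close>

lemma recurrent_orthogonal:
  assumes "recurrent v"
  shows "\<exists>g\<in>leavitt_span. \<exists>g'\<in>leavitt_span. \<exists>h\<in>leavitt_span. \<exists>h'\<in>leavitt_span.
    g' * g = vx v \<and> h' * h = vx v \<and> g' * h = 0 \<and>
    vx v * g * vx v = g \<and> vx v * g' * vx v = g' \<and> vx v * h * vx v = h \<and> vx v * h' * vx v = h'"
proof -
  obtain g h where gh: "awalk v g v" "awalk v h v" "\<not> prefix g h" "\<not> prefix h g"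
    using assms by (auto simp: recurrent_def)
  have v: "v \<in> verts G" using assms recurrent_in_verts by blast
  have "vx v * rp g v * vx v = rp g v" "vx v * gp g v * vx v = gp g v"
    "vx v * rp h v * vx v = rp h v" "vx v * gp h v * vx v = gp h v"
    by (simp_all add: vx_rp[OF gh(1) v] vx_gp[OF gh(1) v] rp_vx[OF gh(1) v] gp_vx[OF gh(1) v]
        vx_rp[OF gh(2) v] vx_gp[OF gh(2) v] rp_vx[OF gh(2) v] gp_vx[OF gh(2) v])
  moreover note gp_rp_same[OF gh(1)] gp_rp_same[OF gh(2)] gp_rp_incomparable[OF gh]
    rp_in_span(2)[OF gh(1)] gp_in_span(2)[OF gh(1)] rp_in_span(2)[OF gh(2)] gp_in_span(2)[OF gh(2)]
  ultimately show ?thesis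
    by (intro bexI[of _ "rp g v"] bexI[of _ "gp g v"] bexI[of _ "rp h v"] bexI[of _ "gp h v"] conjI)
qed

end

section \<open>Rings without unit as subrings of type-class rings\<close>

context nonunital_ring
begin

lemma mult_zero: "x \<in> carrier R \<Longrightarrow> \<zero> \<otimes> x = \<zero>" "x \<in> carrier R \<Longrightarrow> x \<otimes> \<zero> = \<zero>"
proof -
  assume x: "x \<in> carrier R"
  have "\<zero> \<otimes> x \<oplus> \<zero> \<otimes> x = \<zero> \<otimes> x" "x \<otimes> \<zero> \<oplus> x \<otimes> \<zero> = x \<otimes> \<zero>"
    using l_distr[of \<zero> \<zero> x] r_distr[of \<zero> \<zero> x] x by simp_all
  then show "\<zero> \<otimes> x = \<zero>" "x \<otimes> \<zero> = \<zero>"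
    using x m_closed add.l_cancel_one by (metis zero_closed)+
qed

end

lemma (in ring) nonunital_ring: "nonunital_ring R"
  by unfold_locales (auto simp: m_assoc l_distr r_distr)

text \<open>
  The product ranges over all rings carried by subsets of \<^typ>\<open>'a\<close>, so that each of them embeds, as
  one factor, into a single type of class \<^class>\<open>ring\<close>, even when it depends on parameters of a proof.
\<close>

typedef 'a ring_product =
  "{f :: 'a ring \<Rightarrow> 'a. \<forall>R. if nonunital_ring R then f R \<in> carrier R else f R = undefined}"
proof
  show "(\<lambda>R. if nonunital_ring R then \<zero>\<^bsub>R\<^esub> else undefined)
    \<in> {f. \<forall>R. if nonunital_ring R then f R \<in> carrier R else f R = undefined}"
    by (simp add: nonunital_ring_def abelian_group.axioms(1) abelian_monoid.zero_closed)
qed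

setup_lifting type_definition_ring_product

instantiation ring_product :: (type) ring
begin

lift_definition zero_ring_product :: "'a ring_product"
  is "\<lambda>R. if nonunital_ring R then \<zero>\<^bsub>R\<^esub> else undefined"
  by (simp add: nonunital_ring_def abelian_group.axioms(1) abelian_monoid.zero_closed)

lift_definition plus_ring_product :: "'a ring_product \<Rightarrow> 'a ring_product \<Rightarrow> 'a ring_product"
  is "\<lambda>f g R. if nonunital_ring R then f R \<oplus>\<^bsub>R\<^esub> g R else undefined"
  by (auto simp: nonunital_ring_def abelian_group.axioms(1) intro!: abelian_monoid.a_closed split: if_splits)

lift_definition uminus_ring_product :: "'a ring_product \<Rightarrow> 'a ring_product"
  is "\<lambda>f R. if nonunital_ring R then \<ominus>\<^bsub>R\<^esub> f R else undefined"
  by (auto simp: nonunital_ring_def intro!: abelian_group.a_inv_closed split: if_splits)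

lift_definition minus_ring_product :: "'a ring_product \<Rightarrow> 'a ring_product \<Rightarrow> 'a ring_product"
  is "\<lambda>f g R. if nonunital_ring R then f R \<ominus>\<^bsub>R\<^esub> g R else undefined"
  by (auto simp: nonunital_ring_def intro!: abelian_group.minus_closed split: if_splits)

lift_definition times_ring_product :: "'a ring_product \<Rightarrow> 'a ring_product \<Rightarrow> 'a ring_product"
  is "\<lambda>f g R. if nonunital_ring R then f R \<otimes>\<^bsub>R\<^esub> g R else undefined"
  by (auto intro!: nonunital_ring.m_closed split: if_splits)

instance
proof
  fix a b c :: "'a ring_product"
  note ax = nonunital_ring.axioms(1) abelian_group.axioms(1)
  show "a + b + c = a + (b + c)"
    by transfer (auto simp: fun_eq_iff intro!: abelian_monoid.a_assoc ax split: if_splits)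
  show "a + b = b + a"
    by transfer (auto simp: fun_eq_iff intro!: abelian_monoid.a_comm ax split: if_splits)
  show "0 + a = a"
    by transfer (auto simp: fun_eq_iff intro!: abelian_monoid.l_zero ax split: if_splits)
  show "- a + a = 0"
    by transfer (auto simp: fun_eq_iff intro!: abelian_group.l_neg ax split: if_splits)
  show "a - b = a + - b"
    by transfer (auto simp: a_minus_def)
  show "a * b * c = a * (b * c)"
    by transfer (auto simp: fun_eq_iff intro!: nonunital_ring.m_assoc split: if_splits)
  show "(a + b) * c = a * c + b * c"
    by transfer (auto simp: fun_eq_iff intro!: nonunital_ring.l_distr split: if_splits)
  show "a * (b + c) = a * b + a * c"
    by transfer (auto simp: fun_eq_iff intro!: nonunital_ring.r_distr split: if_splits)
qed

end

text \<open>The component at \<open>R\<close> is \<open>x\<close> and every other ring component is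
  zero. Elements outside the carrier go to zero to make the map total.\<close>

lift_definition ring_inject :: "'a ring \<Rightarrow> 'a \<Rightarrow> 'a ring_product"
  is "\<lambda>R x S. if nonunital_ring S then (if S = R \<and> x \<in> carrier R then x else \<zero>\<^bsub>S\<^esub>) else undefined"
  by (auto simp: nonunital_ring_def abelian_group.axioms(1) abelian_monoid.zero_closed)

text \<open>The ring axioms of \<open>R\<close> are pulled back along the injection \<iota>.
  Negatives are required only as preimages, so that no group structure on \<open>R\<close> has to be
  known beforehand.\<close>

locale faithful_ring =
  fixes R :: "('x, 'm) ring_scheme" (structure) and \<iota> :: "'x \<Rightarrow> 'r::ring"
  assumes inj: "inj_on \<iota> (carrier R)"
    and zero_in: "\<zero> \<in> carrier R" and \<iota>_zero: "\<iota> \<zero> = 0"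
    and add_in: "\<lbrakk>x \<in> carrier R; y \<in> carrier R\<rbrakk> \<Longrightarrow> x \<oplus> y \<in> carrier R"
    and \<iota>_add: "\<lbrakk>x \<in> carrier R; y \<in> carrier R\<rbrakk> \<Longrightarrow> \<iota> (x \<oplus> y) = \<iota> x + \<iota> y"
    and mult_in: "\<lbrakk>x \<in> carrier R; y \<in> carrier R\<rbrakk> \<Longrightarrow> x \<otimes> y \<in> carrier R"
    and \<iota>_mult: "\<lbrakk>x \<in> carrier R; y \<in> carrier R\<rbrakk> \<Longrightarrow> \<iota> (x \<otimes> y) = \<iota> x * \<iota> y"
    and neg_in: "x \<in> carrier R \<Longrightarrow> \<exists>y\<in>carrier R. \<iota> y = - \<iota> x"
begin

lemma \<iota>_eqD: "\<lbrakk>\<iota> x = \<iota> y; x \<in> carrier R; y \<in> carrier R\<rbrakk> \<Longrightarrow> x = y"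
  using inj by (simp add: inj_on_def)

lemma nonunital_ring: "nonunital_ring R"
proof (intro nonunital_ring.intro abelian_groupI nonunital_ring_axioms.intro)
  fix x assume x: "x \<in> carrier R"
  then obtain y where "y \<in> carrier R" "\<iota> y = - \<iota> x" using neg_in by blast
  then show "\<exists>y\<in>carrier R. y \<oplus> x = \<zero>"
    using x by (auto intro!: bexI[of _ y] \<iota>_eqD simp: \<iota>_add \<iota>_zero add_in zero_in)
qed (auto intro!: \<iota>_eqD simp: \<iota>_add \<iota>_zero \<iota>_mult add_in zero_in mult_in algebra_simps)

end

sublocale faithful_ring \<subseteq> nonunital_ring R
  by (rule nonunital_ring)

context faithful_ring
begin

lemma \<iota>_a_inv: "x \<in> carrier R \<Longrightarrow> \<iota> (\<ominus> x) = - \<iota> x"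
  using \<iota>_add[of "\<ominus> x" x] l_neg[of x] by (simp add: \<iota>_zero eq_neg_iff_add_eq_0)

lemma \<iota>_finsum:
  fixes n :: nat
  shows "f \<in> {..<n} \<rightarrow> carrier R \<Longrightarrow> \<iota> (\<Oplus>i\<in>{..<n}. f i) = (\<Sum>i<n. \<iota> (f i))"
proof (induction n)
  case (Suc n)
  then have "f \<in> {..<n} \<rightarrow> carrier R" "f n \<in> carrier R" by auto
  then show ?case
    using Suc.IH by (simp add: lessThan_Suc finsum_insert \<iota>_add finsum_closed add.commute)
qed (simp add: \<iota>_zero)

lemma faithful_subring:
  assumes "J \<subseteq> carrier R" "\<zero> \<in> J" "\<And>x y. \<lbrakk>x \<in> J; y \<in> J\<rbrakk> \<Longrightarrow> x \<oplus> y \<in> J"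
    "\<And>x y. \<lbrakk>x \<in> J; y \<in> J\<rbrakk> \<Longrightarrow> x \<otimes> y \<in> J" "\<And>x. x \<in> J \<Longrightarrow> \<ominus> x \<in> J"
  shows "faithful_ring (R\<lparr>carrier := J\<rparr>) \<iota>"
proof -
  have "\<exists>y\<in>J. \<iota> y = - \<iota> x" if "x \<in> J" for x
    using assms(1,5) that \<iota>_a_inv by blast
  then show ?thesis
    using assms inj by unfold_locales (auto simp: \<iota>_zero \<iota>_add \<iota>_mult subset_iff inj_on_def)
qed

end

text \<open>Evaluation at the component \<open>R\<close> gives injectivity. At every other ring
  component only zeros are combined, and these yield zero again.\<close>

lemma ring_inject_faithful:
  fixes R :: "'a ring" (structure)
  assumes "nonunital_ring R"
  shows "faithful_ring R (ring_inject R)"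
proof -
  interpret nonunital_ring R by fact
  have eval: "Rep_ring_product (ring_inject R x) R = x" if "x \<in> carrier R" for x
    using that assms by (simp add: ring_inject.rep_eq)
  have null: "\<zero>\<^bsub>S\<^esub> \<oplus>\<^bsub>S\<^esub> \<zero>\<^bsub>S\<^esub> = \<zero>\<^bsub>S\<^esub>" "\<zero>\<^bsub>S\<^esub> \<otimes>\<^bsub>S\<^esub> \<zero>\<^bsub>S\<^esub> = \<zero>\<^bsub>S\<^esub>" "\<ominus>\<^bsub>S\<^esub> \<zero>\<^bsub>S\<^esub> = \<zero>\<^bsub>S\<^esub>"
    if "nonunital_ring S" for S :: "'a ring"
  proof -
    interpret S: nonunital_ring S by fact
    show "\<zero>\<^bsub>S\<^esub> \<oplus>\<^bsub>S\<^esub> \<zero>\<^bsub>S\<^esub> = \<zero>\<^bsub>S\<^esub>" "\<zero>\<^bsub>S\<^esub> \<otimes>\<^bsub>S\<^esub> \<zero>\<^bsub>S\<^esub> = \<zero>\<^bsub>S\<^esub>" "\<ominus>\<^bsub>S\<^esub> \<zero>\<^bsub>S\<^esub> = \<zero>\<^bsub>S\<^esub>"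
      using S.mult_zero by simp_all
  qed
  show ?thesis
  proof
    show "inj_on (ring_inject R) (carrier R)"
      by (rule inj_onI) (metis eval)
    show "ring_inject R \<zero> = 0"
      by (simp add: Rep_ring_product_inject[symmetric] ring_inject.rep_eq zero_ring_product.rep_eq fun_eq_iff)
    fix x y assume x: "x \<in> carrier R"
    have "ring_inject R (\<ominus> x) = - ring_inject R x"
      using x null
      by (simp add: Rep_ring_product_inject[symmetric] ring_inject.rep_eq uminus_ring_product.rep_eq fun_eq_iff)
    then show "\<exists>y\<in>carrier R. ring_inject R y = - ring_inject R x"
      using x by blast
    assume y: "y \<in> carrier R"
    show "ring_inject R (x \<oplus> y) = ring_inject R x + ring_inject R y"
      using x y null
      by (simp add: Rep_ring_product_inject[symmetric] ring_inject.rep_eq plus_ring_product.rep_eq fun_eq_iff)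
    show "ring_inject R (x \<otimes> y) = ring_inject R x * ring_inject R y"
      using x y null m_closed
      by (simp add: Rep_ring_product_inject[symmetric] ring_inject.rep_eq times_ring_product.rep_eq fun_eq_iff)
  qed (auto intro: m_closed)
qed

section \<open>Quotients that are not division rings\<close>

sublocale nonunital_ideal \<subseteq> abelian_subgroup I R
  by (rule abelian_subgroupI3) (fact additive_subgroup_axioms, fact abelian_group_axioms)

context nonunital_ideal
begin

lemma coset_eq_ideal_iff:
  assumes "x \<in> carrier R" shows "I +> x = I \<longleftrightarrow> x \<in> I"
  using assms a_rcos_self a_coset_join2[OF assms a_subgroup] by auto

text \<open>The product of cosets is a union over all representatives. Products of representatives
  differ from \<open>x \<otimes> y\<close> by elements of \<open>I\<close>, so all cosets in the
  union coincide.\<close>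

lemma rcoset_mult_coset:
  assumes x: "x \<in> carrier R" and y: "y \<in> carrier R"
  shows "rcoset_mult R I (I +> x) (I +> y) = I +> (x \<otimes> y)"
proof -
  have eq: "I +> (a \<otimes> b) = I +> (x \<otimes> y)" if a: "a \<in> I +> x" and b: "b \<in> I +> y" for a b
  proof -
    obtain h k where h: "h \<in> I" "a = h \<oplus> x" and k: "k \<in> I" "b = k \<oplus> y"
      using a b by (auto simp: a_r_coset_def r_coset_def)
    have hk: "h \<in> carrier R" "k \<in> carrier R" using h k a_subset by auto
    have "a \<otimes> b = (h \<otimes> (k \<oplus> y) \<oplus> x \<otimes> k) \<oplus> x \<otimes> y"
      using h k hk x y by (simp add: l_distr r_distr m_closed a_ac)
    moreover have "h \<otimes> (k \<oplus> y) \<oplus> x \<otimes> k \<in> I"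
      using I_r_closed[OF h(1), of "k \<oplus> y"] I_l_closed[OF k(1) x] hk y by simp
    ultimately have "a \<otimes> b \<in> I +> (x \<otimes> y)"
      by (auto simp: a_r_coset_def r_coset_def)
    then show ?thesis using a_repr_independence' x y m_closed by metis
  qed
  have "I +> x \<noteq> {}" "I +> y \<noteq> {}" using a_rcos_self x y by blast+
  then show ?thesis unfolding rcoset_mult_def using eq by auto
qed

text \<open>In a division ring the nonzero cosets of \<open>x\<close> and \<open>y\<close> would be
  units, and so would their product, which is the zero coset.\<close>

lemma quotient_not_division_ring:
  assumes "x \<in> carrier R" "y \<in> carrier R" "x \<notin> I" "y \<notin> I" "x \<otimes> y \<in> I"
  shows "\<not> is_division_ring (R Quot I)"
proof
  assume "is_division_ring (R Quot I)"
  then obtain e where D: "ring ((R Quot I)\<lparr>one := e\<rparr>)"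
    and U: "Units ((R Quot I)\<lparr>one := e\<rparr>) = carrier (R Quot I) - {I}"
    unfolding is_division_ring_def by (auto simp: FactRing_def)
  interpret D: ring "(R Quot I)\<lparr>one := e\<rparr>" by (fact D)
  have "I +> z \<in> Units ((R Quot I)\<lparr>one := e\<rparr>)" if "z \<in> carrier R" "z \<notin> I" for z
    using that a_rcosetsI[OF a_subset] coset_eq_ideal_iff unfolding U by (simp add: FactRing_def)
  then have "I +> x \<otimes> y \<in> Units ((R Quot I)\<lparr>one := e\<rparr>)"
    using D.Units_m_closed[of "I +> x" "I +> y"] assms rcoset_mult_coset by (simp add: FactRing_def)
  then show False
    using assms(5) coset_eq_ideal_iff a_subset unfolding U by auto
qed

text \<open>The only coset is zero, which is excluded from the units, whereas the unit element of a
  ring is a unit.\<close>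

lemma trivial_quotient_not_division_ring:
  assumes "I = carrier R"
  shows "\<not> is_division_ring (R Quot I)"
proof
  assume "is_division_ring (R Quot I)"
  then obtain e where D: "ring ((R Quot I)\<lparr>one := e\<rparr>)"
    and U: "Units ((R Quot I)\<lparr>one := e\<rparr>) = carrier (R Quot I) - {I}"
    unfolding is_division_ring_def by (auto simp: FactRing_def)
  interpret D: ring "(R Quot I)\<lparr>one := e\<rparr>" by (fact D)
  have "carrier (R Quot I) \<subseteq> {I}"
    using coset_eq_ideal_iff assms by (auto simp: FactRing_def A_RCOSETS_def' a_r_coset_def')
  then show False using D.Units_one_closed unfolding U by blast
qed

end

section \<open>The ideal generated by recurrent vertices\<close>

context leavitt_family
begin

lemma span_uminus: "x \<in> leavitt_span \<Longrightarrow> - x \<in> leavitt_span"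
  unfolding leavitt_span_def
proof (rule additive_span_uminus)
  fix b assume "b \<in> (\<Union>v w m. monomials v w m)"
  then obtain v w m c p q u where b: "awalk v p u" "awalk w q u" "b = sc c * (rp p u * gp q u)"
    unfolding monomials_def by blast
  have "sc (- c) = - sc c" using sc_add[of "- c" c] sc_zero by (simp add: eq_neg_iff_add_eq_0)
  then have "- b = sc (- c) * (rp p u * gp q u)" by (simp add: b(3))
  then show "- b \<in> additive_span (\<Union>v w m. monomials v w m)"
    using monomials_in_span[OF b(1,2), of "- c"] by (simp add: leavitt_span_def)
qed

lemma vertex_ideal_mult_left:
  assumes "a \<in> leavitt_span" "x \<in> vertex_ideal X" shows "a * x \<in> vertex_ideal X"
  using assms(2) unfolding vertex_ideal_def
proof (rule additive_span_mult_left[rotated], fold vertex_ideal_def)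
  fix b assume "b \<in> {x * vx v * y |x v y. x \<in> leavitt_span \<and> v \<in> X \<and> y \<in> leavitt_span}"
  then obtain x v y where b: "b = x * vx v * y" "x \<in> leavitt_span" "v \<in> X" "y \<in> leavitt_span" by blast
  have "a * b = (a * x) * vx v * y" by (simp add: b(1) mult.assoc)
  then show "a * b \<in> vertex_ideal X" using b span_mult[OF assms(1) b(2)] vertex_ideal_base by simp
qed

lemma vertex_ideal_mult_right:
  assumes "a \<in> leavitt_span" "x \<in> vertex_ideal X" shows "x * a \<in> vertex_ideal X"
  using assms(2) unfolding vertex_ideal_def
proof (rule additive_span_mult_right[rotated], fold vertex_ideal_def)
  fix b assume "b \<in> {x * vx v * y |x v y. x \<in> leavitt_span \<and> v \<in> X \<and> y \<in> leavitt_span}"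
  then obtain x v y where b: "b = x * vx v * y" "x \<in> leavitt_span" "v \<in> X" "y \<in> leavitt_span" by blast
  have "b * a = x * vx v * (y * a)" by (simp add: b(1) mult.assoc)
  then show "b * a \<in> vertex_ideal X" using b span_mult[OF b(4) assms(1)] vertex_ideal_base by simp
qed

lemma vertex_ideal_uminus: "x \<in> vertex_ideal X \<Longrightarrow> - x \<in> vertex_ideal X"
  unfolding vertex_ideal_def
proof (rule additive_span_uminus, fold vertex_ideal_def)
  fix b assume "b \<in> {x * vx v * y |x v y. x \<in> leavitt_span \<and> v \<in> X \<and> y \<in> leavitt_span}"
  then obtain x v y where b: "b = x * vx v * y" "x \<in> leavitt_span" "v \<in> X" "y \<in> leavitt_span" by blast
  have "- b = (- x) * vx v * y" by (simp add: b(1))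
  show "- b \<in> vertex_ideal X"
    unfolding \<open>- b = _\<close> using b(3,4) span_uminus[OF b(2)] by (intro vertex_ideal_base)
qed

lemma vertex_ideal_in_span:
  assumes "X \<subseteq> verts G" "x \<in> vertex_ideal X" shows "x \<in> leavitt_span"
  using assms(2) unfolding vertex_ideal_def leavitt_span_def
proof (rule additive_span_subset[rotated], fold leavitt_span_def)
  fix b assume "b \<in> {x * vx v * y |x v y. x \<in> leavitt_span \<and> v \<in> X \<and> y \<in> leavitt_span}"
  then show "b \<in> leavitt_span" using assms(1) by (auto intro!: span_mult vx_in_span)
qed

end

text \<open>Identifies a ring \<open>R\<close> given by its carrier with the span of monomials in a
  type-class ring, so that results proved in the span can be transported to
  \<open>R\<close>.\<close>

locale leavitt_ring = leavitt_family G vx ed gh sc + faithful_ring R \<iota>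
  for G :: "('a, 'b) pre_digraph" (structure) and vx :: "'a \<Rightarrow> 'r::ring" and ed gh
    and sc :: "'k::field \<Rightarrow> 'r" and R :: "('x, 'm) ring_scheme" and \<iota> :: "'x \<Rightarrow> 'r" +
  fixes vertex :: "'a \<Rightarrow> 'x"
  assumes image: "\<iota> ` carrier R = leavitt_span"
    and vertex_in: "v \<in> verts G \<Longrightarrow> vertex v \<in> carrier R"
    and \<iota>_vertex: "v \<in> verts G \<Longrightarrow> \<iota> (vertex v) = vx v"
begin

definition recurrent_ideal :: "'a set \<Rightarrow> 'x set" where
  "recurrent_ideal X = {a \<in> carrier R. \<iota> a \<in> vertex_ideal X}"

lemma \<iota>_in_span: "a \<in> carrier R \<Longrightarrow> \<iota> a \<in> leavitt_span"
  using image by blast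

lemma recurrent_ideal_preimage:
  assumes "X \<subseteq> verts G" "z \<in> vertex_ideal X" shows "\<exists>a\<in>recurrent_ideal X. \<iota> a = z"
proof -
  have "z \<in> \<iota> ` carrier R" using vertex_ideal_in_span[OF assms] image by simp
  then show ?thesis using assms(2) unfolding recurrent_ideal_def by blast
qed

lemma recurrent_ideal_closed:
  "\<zero>\<^bsub>R\<^esub> \<in> recurrent_ideal X"
  "\<lbrakk>a \<in> recurrent_ideal X; b \<in> recurrent_ideal X\<rbrakk> \<Longrightarrow> a \<oplus>\<^bsub>R\<^esub> b \<in> recurrent_ideal X"
  "a \<in> recurrent_ideal X \<Longrightarrow> \<ominus>\<^bsub>R\<^esub> a \<in> recurrent_ideal X"
  "\<lbrakk>a \<in> recurrent_ideal X; x \<in> carrier R\<rbrakk> \<Longrightarrow> x \<otimes>\<^bsub>R\<^esub> a \<in> recurrent_ideal X"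
  "\<lbrakk>a \<in> recurrent_ideal X; x \<in> carrier R\<rbrakk> \<Longrightarrow> a \<otimes>\<^bsub>R\<^esub> x \<in> recurrent_ideal X"
  by (auto simp: recurrent_ideal_def \<iota>_zero \<iota>_add \<iota>_a_inv \<iota>_mult mult_in
      intro: vertex_ideal_uminus vertex_ideal_mult_left vertex_ideal_mult_right \<iota>_in_span)
    (auto simp: vertex_ideal_def intro: additive_span.zero additive_span_plus)

lemma recurrent_ideal_subset: "recurrent_ideal X \<subseteq> carrier R"
  by (auto simp: recurrent_ideal_def)

lemma vertex_in_recurrent_ideal:
  assumes "v \<in> X" "v \<in> verts G" shows "vertex v \<in> recurrent_ideal X"
proof -
  have "vx v * vx v * vx v \<in> vertex_ideal X"
    using assms by (intro vertex_ideal_base vx_in_span)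
  then show ?thesis
    using assms by (simp add: recurrent_ideal_def vertex_in \<iota>_vertex vx_vx)
qed

lemma recurrent_ideal_ideal: "nonunital_ideal (recurrent_ideal X) R"
proof (intro nonunital_ideal.intro additive_subgroup.intro subgroup.intro nonunital_ideal_axioms.intro)
  show "inv\<^bsub>add_monoid R\<^esub> a \<in> recurrent_ideal X" if "a \<in> recurrent_ideal X" for a
    using recurrent_ideal_closed(3)[OF that] by (simp add: a_inv_def)
qed (use recurrent_ideal_closed recurrent_ideal_subset nonunital_ring in auto)

text \<open>The last assumption has outer factors in the ideal itself, so the lemma applies both to
  ideals of \<open>R\<close> and to ideals of the subring \<open>recurrent_ideal X\<close>.\<close>

lemma recurrent_ideal_least:
  assumes X: "X \<subseteq> verts G" and I: "I \<subseteq> carrier R" "\<zero>\<^bsub>R\<^esub> \<in> I"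
    "\<And>a b. \<lbrakk>a \<in> I; b \<in> I\<rbrakk> \<Longrightarrow> a \<oplus>\<^bsub>R\<^esub> b \<in> I"
    "\<And>p v q. \<lbrakk>p \<in> recurrent_ideal X; v \<in> X; q \<in> recurrent_ideal X\<rbrakk>
      \<Longrightarrow> p \<otimes>\<^bsub>R\<^esub> vertex v \<otimes>\<^bsub>R\<^esub> q \<in> I"
  shows "recurrent_ideal X \<subseteq> I"
proof
  fix a assume a: "a \<in> recurrent_ideal X"
  have "\<exists>a\<in>I. \<iota> a = z" if "z \<in> vertex_ideal X" for z
    using that unfolding vertex_ideal_def
  proof induction
    case zero
    then show ?case using I(2) \<iota>_zero by blast
  next
    case (add b z)
    then obtain x v y where b: "b = x * vx v * y" "x \<in> leavitt_span" "v \<in> X" "y \<in> leavitt_span"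
      by blast
    have v: "v \<in> verts G" using X b(3) by blast
    \<comment> \<open>Repeating the idempotent \<open>vx v\<close> moves the outer factors into the
      ideal without changing the product.\<close>
    have "x * vx v * vx v \<in> vertex_ideal X" "vx v * vx v * y \<in> vertex_ideal X"
      using b v by (auto intro!: vertex_ideal_base vx_in_span)
    then obtain p q where p: "p \<in> recurrent_ideal X" "\<iota> p = x * vx v * vx v"
      and q: "q \<in> recurrent_ideal X" "\<iota> q = vx v * vx v * y"
      using recurrent_ideal_preimage[OF X] by metis
    have "\<iota> (p \<otimes>\<^bsub>R\<^esub> vertex v \<otimes>\<^bsub>R\<^esub> q) = x * (vx v * vx v * vx v * vx v * vx v) * y"
      using p q v recurrent_ideal_subset by (simp add: \<iota>_mult mult_in vertex_in \<iota>_vertex subset_iff mult.assoc)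
    also have "\<dots> = b" using v by (simp add: b(1) vx_vx)
    finally have "\<iota> (p \<otimes>\<^bsub>R\<^esub> vertex v \<otimes>\<^bsub>R\<^esub> q) = b" .
    moreover obtain a where "a \<in> I" "\<iota> a = z" using add.IH by blast
    moreover have "p \<otimes>\<^bsub>R\<^esub> vertex v \<otimes>\<^bsub>R\<^esub> q \<in> I" using I(4) p q b(3) by blast
    ultimately show ?case using I(1,3) \<iota>_add by (metis subsetD)
  qed
  then obtain a' where "a' \<in> I" "\<iota> a' = \<iota> a" using a by (auto simp: recurrent_ideal_def)
  then show "a \<in> I" using \<iota>_eqD a I(1) recurrent_ideal_subset by (metis subsetD)
qed

lemma recurrent_ideal_eq_genideal:
  assumes X: "X \<subseteq> verts G"
  shows "nonunital_genideal R (vertex ` X) = recurrent_ideal X"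
proof
  show "nonunital_genideal R (vertex ` X) \<subseteq> recurrent_ideal X"
    unfolding nonunital_genideal_def
    using recurrent_ideal_ideal vertex_in_recurrent_ideal X by blast
  show "recurrent_ideal X \<subseteq> nonunital_genideal R (vertex ` X)"
    unfolding nonunital_genideal_def
  proof (intro Inter_greatest)
    fix I assume "I \<in> {I. nonunital_ideal I R \<and> vertex ` X \<subseteq> I}"
    then interpret I: nonunital_ideal I R by simp
    have "vertex v \<in> I" if "v \<in> X" for v using that \<open>I \<in> _\<close> by blast
    then show "recurrent_ideal X \<subseteq> I"
      using recurrent_ideal_subset
      by (intro recurrent_ideal_least[OF X] I.a_subset I.zero_closed I.a_closed I.I_r_closed I.I_l_closed) auto
  qed
qed

lemma recurrent_ideal_faithful: "faithful_ring (R\<lparr>carrier := recurrent_ideal X\<rparr>) \<iota>"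
  using recurrent_ideal_closed[where X = X] recurrent_ideal_subset[of X]
  by (intro faithful_subring) (auto simp: subset_iff)

text \<open>If \<open>I\<close> contains all generating vertices, it is everything and the quotient
  is trivial. Otherwise a vertex outside \<open>I\<close> yields two elements outside
  \<open>I\<close> whose product is zero.\<close>

lemma recurrent_ideal_no_division_quotient:
  assumes X: "\<And>v. v \<in> X \<Longrightarrow> recurrent v"
    and I: "nonunital_ideal I (R\<lparr>carrier := recurrent_ideal X\<rparr>)"
  shows "\<not> is_division_ring (R\<lparr>carrier := recurrent_ideal X\<rparr> Quot I)"
proof -
  let ?J = "recurrent_ideal X"
  interpret I: nonunital_ideal I "R\<lparr>carrier := ?J\<rparr>" by (fact I)
  have XV: "X \<subseteq> verts G" using X recurrent_in_verts by blast
  have IJ: "I \<subseteq> ?J" using I.a_subset by simp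
  have l: "x \<otimes>\<^bsub>R\<^esub> a \<in> I" and r: "a \<otimes>\<^bsub>R\<^esub> x \<in> I" if "a \<in> I" "x \<in> ?J" for a x
    using I.I_l_closed[of a x] I.I_r_closed[of a x] that by simp_all
  have zero: "\<zero>\<^bsub>R\<^esub> \<in> I"
    using additive_subgroup.zero_closed[OF I.additive_subgroup_axioms] by simp
  have add: "a \<oplus>\<^bsub>R\<^esub> b \<in> I" if "a \<in> I" "b \<in> I" for a b
    using additive_subgroup.a_closed[OF I.additive_subgroup_axioms] that by simp
  show ?thesis
  proof (cases "\<forall>v\<in>X. vertex v \<in> I")
    case True
    then have "?J \<subseteq> I"
      using zero add IJ recurrent_ideal_subset[of X] l r
      by (intro recurrent_ideal_least[OF XV]) auto
    then show ?thesis using IJ by (intro I.trivial_quotient_not_division_ring) auto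
  next
    case False
    then obtain v where v: "v \<in> X" "vertex v \<notin> I" by blast
    then have vG: "v \<in> verts G" using XV by blast
    obtain g g' h h' where in_span: "g \<in> leavitt_span" "g' \<in> leavitt_span" "h \<in> leavitt_span" "h' \<in> leavitt_span"
      and rel: "g' * g = vx v" "h' * h = vx v" "g' * h = 0"
      and corner: "vx v * g * vx v = g" "vx v * g' * vx v = g'" "vx v * h * vx v = h" "vx v * h' * vx v = h'"
      using recurrent_orthogonal[OF X[OF v(1)]] by blast
    \<comment> \<open>The ideal \<open>I\<close> absorbs only factors from
      \<open>recurrent_ideal X\<close>, so the paths and their adjoints must be placed
      there.\<close>
    have ideal: "x \<in> vertex_ideal X" if "x \<in> leavitt_span" "vx v * x * vx v = x" for x
      using vertex_ideal_base[of "vx v * x" v X "vx v"] that v(1) vG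
      by (simp add: span_mult vx_in_span mult.assoc vx_vx)
    obtain a a' b b' where J: "a \<in> ?J" "a' \<in> ?J" "b \<in> ?J" "b' \<in> ?J"
      and eq: "\<iota> a = g" "\<iota> a' = g'" "\<iota> b = h" "\<iota> b' = h'"
      using recurrent_ideal_preimage[OF XV ideal] in_span corner by metis
    have car: "a \<in> carrier R" "a' \<in> carrier R" "b \<in> carrier R" "b' \<in> carrier R"
      using J recurrent_ideal_subset by auto
    have "a' \<otimes>\<^bsub>R\<^esub> a = vertex v" "b' \<otimes>\<^bsub>R\<^esub> b = vertex v" "a' \<otimes>\<^bsub>R\<^esub> b = \<zero>\<^bsub>R\<^esub>"
      using car vG eq rel by (auto intro!: \<iota>_eqD simp: \<iota>_mult \<iota>_zero mult_in vertex_in \<iota>_vertex)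
    moreover have "a' \<notin> I" "b \<notin> I"
      using calculation v(2) r[OF _ J(1), of a'] l[OF _ J(4), of b] by auto
    ultimately show ?thesis
      using J zero by (intro I.quotient_not_division_ring[of a' b]) auto
  qed
qed

text \<open>The sum of products is carried along \<iota> into the type-class ring, factored there,
  and the two factors are pulled back.\<close>

lemma recurrent_ideal_factor:
  assumes X: "\<And>v. v \<in> X \<Longrightarrow> recurrent v" and a: "a \<in> recurrent_ideal X"
    and b: "b \<in> two_sided_multiples (R\<lparr>carrier := recurrent_ideal X\<rparr>) a"
  shows "\<exists>x\<in>recurrent_ideal X. \<exists>y\<in>recurrent_ideal X. b = x \<otimes>\<^bsub>R\<^esub> a \<otimes>\<^bsub>R\<^esub> y"
proof -
  let ?J = "recurrent_ideal X"
  interpret J: faithful_ring "R\<lparr>carrier := ?J\<rparr>" \<iota> by (rule recurrent_ideal_faithful)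
  have XV: "X \<subseteq> verts G" using X recurrent_in_verts by blast
  obtain n :: nat and x y where xy: "x \<in> {..<n} \<rightarrow> ?J" "y \<in> {..<n} \<rightarrow> ?J"
    and b_eq: "b = (\<Oplus>\<^bsub>R\<lparr>carrier := ?J\<rparr>\<^esub>i\<in>{..<n}. x i \<otimes>\<^bsub>R\<^esub> a \<otimes>\<^bsub>R\<^esub> y i)"
    using b unfolding two_sided_multiples_def by auto
  have car: "a \<in> carrier R" using a recurrent_ideal_subset by blast
  have closed: "(\<lambda>i. x i \<otimes>\<^bsub>R\<^esub> a \<otimes>\<^bsub>R\<^esub> y i) \<in> {..<n} \<rightarrow> ?J"
    using xy car recurrent_ideal_closed(5)[where X = X] recurrent_ideal_subset[of X]
    by (auto simp: Pi_iff subset_iff)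
  then have bJ: "b \<in> ?J" unfolding b_eq using J.finsum_closed by simp
  have "\<iota> b = (\<Sum>i<n. \<iota> (x i \<otimes>\<^bsub>R\<^esub> a \<otimes>\<^bsub>R\<^esub> y i))"
    unfolding b_eq using J.\<iota>_finsum closed by simp
  also have "\<dots> = (\<Sum>i<n. \<iota> (x i) * \<iota> a * \<iota> (y i))"
    using xy car recurrent_ideal_subset[of X] by (intro sum.cong) (auto simp: \<iota>_mult mult_in Pi_iff subset_iff)
  also have "\<dots> \<in> multiples_in (vertex_ideal X) (\<iota> a)"
    unfolding multiples_in_def
    using xy by (intro additive_span_sum additive_span_base) (auto simp: recurrent_ideal_def Pi_iff)
  finally obtain s t where st: "s \<in> vertex_ideal X" "t \<in> vertex_ideal X" "\<iota> b = s * \<iota> a * t"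
    using vertex_ideal_properly_infinite[OF X \<iota>_in_span[OF car]] by blast
  then obtain p q where pq: "p \<in> ?J" "\<iota> p = s" "q \<in> ?J" "\<iota> q = t"
    using recurrent_ideal_preimage[OF XV] by metis
  then have "b = p \<otimes>\<^bsub>R\<^esub> a \<otimes>\<^bsub>R\<^esub> q"
    using st(3) bJ car recurrent_ideal_subset by (intro \<iota>_eqD) (auto simp: \<iota>_mult mult_in subset_iff)
  then show ?thesis using pq by blast
qed

lemma recurrent_vertices_purely_infinite:
  assumes X: "\<And>v. v \<in> X \<Longrightarrow> recurrent v"
  shows "purely_infinite_ideal (nonunital_genideal R (vertex ` X)) R"
proof -
  have "purely_infinite_ring (R\<lparr>carrier := recurrent_ideal X\<rparr>)"
  proof (intro purely_infinite_ring.intro purely_infinite_ring_axioms.intro)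
    show "nonunital_ring (R\<lparr>carrier := recurrent_ideal X\<rparr>)"
      using recurrent_ideal_faithful by (rule faithful_ring.nonunital_ring)
  qed (use recurrent_ideal_no_division_quotient[OF X] recurrent_ideal_factor[OF X] in auto)
  moreover have "nonunital_genideal R (vertex ` X) = recurrent_ideal X"
    using X recurrent_in_verts by (intro recurrent_ideal_eq_genideal) blast
  ultimately show ?thesis unfolding purely_infinite_ideal_def using recurrent_ideal_ideal by simp
qed

end

section \<open>Leavitt path algebras\<close>

lemma poly_mapping_sum_single:
  "(\<Sum>w\<in>Poly_Mapping.keys p. Poly_Mapping.single w (Poly_Mapping.lookup p w)) = p"
  by (rule poly_mapping_eqI)
    (simp add: lookup_sum lookup_single when_def sum.delta in_keys_iff)

lemma free_algebra_simps:
  "mult (free_algebra X) = (*)" "one (free_algebra X) = 1"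
  "zero (free_algebra X) = 0" "add (free_algebra X) = (+)"
  by (simp_all add: free_algebra_def)

lemma free_algebra_mem:
  "p \<in> carrier (free_algebra X) \<longleftrightarrow> (\<forall>w\<in>Poly_Mapping.keys p. set w \<subseteq> X)"
  by (simp add: free_algebra_def)

lemma free_algebra_closed:
  "0 \<in> carrier (free_algebra X)" "1 \<in> carrier (free_algebra X)"
  "p \<in> carrier (free_algebra X) \<Longrightarrow> - p \<in> carrier (free_algebra X)"
  "\<lbrakk>p \<in> carrier (free_algebra X); q \<in> carrier (free_algebra X)\<rbrakk> \<Longrightarrow> p + q \<in> carrier (free_algebra X)"
  "\<lbrakk>p \<in> carrier (free_algebra X); q \<in> carrier (free_algebra X)\<rbrakk> \<Longrightarrow> p - q \<in> carrier (free_algebra X)"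
  "\<lbrakk>p \<in> carrier (free_algebra X); q \<in> carrier (free_algebra X)\<rbrakk> \<Longrightarrow> p * q \<in> carrier (free_algebra X)"
proof -
  show "p + q \<in> carrier (free_algebra X)"
    if "p \<in> carrier (free_algebra X)" "q \<in> carrier (free_algebra X)"
    using that keys_add[of p q] by (auto simp: free_algebra_mem)
  show "p - q \<in> carrier (free_algebra X)"
    if "p \<in> carrier (free_algebra X)" "q \<in> carrier (free_algebra X)"
    using that keys_diff[of p q] by (auto simp: free_algebra_mem)
  show "p * q \<in> carrier (free_algebra X)"
    if "p \<in> carrier (free_algebra X)" "q \<in> carrier (free_algebra X)"
    unfolding free_algebra_mem
  proof
    fix w assume "w \<in> Poly_Mapping.keys (p * q)"
    then obtain a b where "w = a + b" "a \<in> Poly_Mapping.keys p" "b \<in> Poly_Mapping.keys q"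
      using keys_mult[of p q] by blast
    then show "set w \<subseteq> X" using that by (auto simp: free_algebra_mem plus_list_def)
  qed
qed (auto simp: free_algebra_mem zero_list_def)

lemma free_algebra_single: "set w \<subseteq> X \<Longrightarrow> Poly_Mapping.single w c \<in> carrier (free_algebra X)"
  by (simp add: free_algebra_mem)

lemma free_algebra_sum:
  "(\<And>i. i \<in> A \<Longrightarrow> f i \<in> carrier (free_algebra X)) \<Longrightarrow> sum f A \<in> carrier (free_algebra X)"
  by (induction A rule: infinite_finite_induct) (auto intro: free_algebra_closed)

lemma ring_free_algebra: "ring (free_algebra X :: ('g list \<Rightarrow>\<^sub>0 'k::field) ring)"
proof (intro ringI abelian_groupI monoidI)
  fix p :: "'g list \<Rightarrow>\<^sub>0 'k" assume "p \<in> carrier (free_algebra X)"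
  then show "\<exists>q\<in>carrier (free_algebra X). q \<oplus>\<^bsub>free_algebra X\<^esub> p = \<zero>\<^bsub>free_algebra X\<^esub>"
    by (intro bexI[of _ "- p"]) (auto simp: free_algebra_simps free_algebra_closed)
qed (auto simp: free_algebra_simps free_algebra_closed algebra_simps)

lemma free_nonunital_algebra_mem:
  "p \<in> carrier (free_nonunital_algebra X) \<longleftrightarrow> p \<in> carrier (free_algebra X) \<and> [] \<notin> Poly_Mapping.keys p"
  by (simp add: free_nonunital_algebra_def)

lemma free_nonunital_algebra_closed:
  "0 \<in> carrier (free_nonunital_algebra X)"
  "p \<in> carrier (free_nonunital_algebra X) \<Longrightarrow> - p \<in> carrier (free_nonunital_algebra X)"
  "\<lbrakk>p \<in> carrier (free_nonunital_algebra X); q \<in> carrier (free_nonunital_algebra X)\<rbrakk>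
    \<Longrightarrow> p + q \<in> carrier (free_nonunital_algebra X)"
  "\<lbrakk>p \<in> carrier (free_algebra X); q \<in> carrier (free_nonunital_algebra X)\<rbrakk>
    \<Longrightarrow> p * q \<in> carrier (free_nonunital_algebra X)"
proof -
  show "p + q \<in> carrier (free_nonunital_algebra X)"
    if "p \<in> carrier (free_nonunital_algebra X)" "q \<in> carrier (free_nonunital_algebra X)"
    using that keys_add[of p q] by (auto simp: free_nonunital_algebra_mem free_algebra_closed)
  show "p * q \<in> carrier (free_nonunital_algebra X)"
    if "p \<in> carrier (free_algebra X)" "q \<in> carrier (free_nonunital_algebra X)"
  proof -
    have "[] \<notin> Poly_Mapping.keys (p * q)"
    proof
      assume "[] \<in> Poly_Mapping.keys (p * q)"
      then obtain a b where "[] = a @ b" "b \<in> Poly_Mapping.keys q"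
        using keys_mult[of p q] unfolding plus_list_def by blast
      then show False using that(2) by (simp add: free_nonunital_algebra_mem)
    qed
    then show ?thesis using that by (simp add: free_nonunital_algebra_mem free_algebra_closed)
  qed
qed (auto simp: free_nonunital_algebra_mem free_algebra_closed)

section \<open>Embedding of the Leavitt path algebra into a type-class ring\<close>

context wf_digraph
begin

lemma lpa_relators_in_free_algebra:
  "lpa_relators G \<subseteq> carrier (free_algebra (lpa_gens G))"
proof
  fix p :: "('a, 'b) lpa_gen list \<Rightarrow>\<^sub>0 'k::field" assume "p \<in> lpa_relators G"
  then show "p \<in> carrier (free_algebra (lpa_gens G))"
    by cases (auto intro!: free_algebra_closed free_algebra_single free_algebra_sum
        simp: lpa_gens_def regular_vertex_def out_arcs_def split: if_splits)
qed

lemma lpa_ideal_ideal: "ideal (lpa_ideal G :: (('a, 'b) lpa_gen list \<Rightarrow>\<^sub>0 'k::field) set) (free_algebra (lpa_gens G))"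
  unfolding lpa_ideal_def
  by (intro ring.genideal_ideal ring_free_algebra lpa_relators_in_free_algebra)

text \<open>An auxiliary unital ring containing the Leavitt path algebra. The classes of constant
  polynomials in it serve as the scalars \<open>sc c\<close>.\<close>

definition unital_lpa :: "'k::field itself \<Rightarrow> (('a, 'b) lpa_gen list \<Rightarrow>\<^sub>0 'k) set ring" where
  "unital_lpa K = free_algebra (lpa_gens G) Quot lpa_ideal G"

definition lpa_coset :: "(('a, 'b) lpa_gen list \<Rightarrow>\<^sub>0 'k::field) \<Rightarrow> (('a, 'b) lpa_gen list \<Rightarrow>\<^sub>0 'k) set" where
  "lpa_coset p = lpa_ideal G +>\<^bsub>free_algebra (lpa_gens G)\<^esub> p"

definition lpa_inject :: "(('a, 'b) lpa_gen list \<Rightarrow>\<^sub>0 'k::field) set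
    \<Rightarrow> (('a, 'b) lpa_gen list \<Rightarrow>\<^sub>0 'k) set ring_product" where
  "lpa_inject = ring_inject (unital_lpa TYPE('k))"

lemma unital_lpa_faithful: "faithful_ring (unital_lpa TYPE('k::field)) lpa_inject"
  unfolding lpa_inject_def unital_lpa_def
  by (intro ring_inject_faithful ring.nonunital_ring ideal.quotient_is_ring lpa_ideal_ideal)

lemma lpa_coset_ops:
  fixes p q :: "('a, 'b) lpa_gen list \<Rightarrow>\<^sub>0 'k::field"
  assumes "p \<in> carrier (free_algebra (lpa_gens G))" "q \<in> carrier (free_algebra (lpa_gens G))"
  shows "lpa_coset p \<in> carrier (unital_lpa TYPE('k))"
    and "lpa_coset p \<oplus>\<^bsub>unital_lpa TYPE('k)\<^esub> lpa_coset q = lpa_coset (p + q)"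
    and "lpa_coset p \<otimes>\<^bsub>unital_lpa TYPE('k)\<^esub> lpa_coset q = lpa_coset (p * q)"
proof -
  interpret ideal "lpa_ideal G :: (('a, 'b) lpa_gen list \<Rightarrow>\<^sub>0 'k) set" "free_algebra (lpa_gens G)"
    by (rule lpa_ideal_ideal)
  show "lpa_coset p \<in> carrier (unital_lpa TYPE('k))"
    using assms a_rcosetsI[OF a_subset] by (simp add: lpa_coset_def unital_lpa_def FactRing_def)
  show "lpa_coset p \<oplus>\<^bsub>unital_lpa TYPE('k)\<^esub> lpa_coset q = lpa_coset (p + q)"
    using a_rcos_sum[OF assms] by (simp add: lpa_coset_def unital_lpa_def FactRing_def free_algebra_simps)
  show "lpa_coset p \<otimes>\<^bsub>unital_lpa TYPE('k)\<^esub> lpa_coset q = lpa_coset (p * q)"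
    using rcoset_mult_add[OF assms] by (simp add: lpa_coset_def unital_lpa_def FactRing_def free_algebra_simps)
qed

definition lpa_rep :: "(('a, 'b) lpa_gen list \<Rightarrow>\<^sub>0 'k::field)
    \<Rightarrow> (('a, 'b) lpa_gen list \<Rightarrow>\<^sub>0 'k) set ring_product" where
  "lpa_rep p = lpa_inject (lpa_coset p)"

lemma lpa_rep_ops:
  assumes "p \<in> carrier (free_algebra (lpa_gens G))" "q \<in> carrier (free_algebra (lpa_gens G))"
  shows "lpa_rep (p + q) = lpa_rep p + lpa_rep q" and "lpa_rep (p * q) = lpa_rep p * lpa_rep q"
  unfolding lpa_rep_def
  using lpa_coset_ops[OF assms] lpa_coset_ops(1)[OF assms(2,1)]
  by (metis faithful_ring.\<iota>_add unital_lpa_faithful, metis faithful_ring.\<iota>_mult unital_lpa_faithful)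

lemma lpa_rep_zero: "lpa_rep 0 = 0"
  using lpa_rep_ops(1)[of 0 0] free_algebra_closed(1)[of "lpa_gens G"] by simp

lemma lpa_rep_minus:
  assumes "p \<in> carrier (free_algebra (lpa_gens G))"
  shows "lpa_rep (- p) = - lpa_rep p"
  using lpa_rep_ops(1)[of "- p" p] free_algebra_closed(3)[OF assms] assms
  by (simp add: eq_neg_iff_add_eq_0 lpa_rep_zero)

lemma lpa_rep_sum:
  "(\<And>i. i \<in> A \<Longrightarrow> f i \<in> carrier (free_algebra (lpa_gens G)))
    \<Longrightarrow> lpa_rep (sum f A) = (\<Sum>i\<in>A. lpa_rep (f i))"
  by (induction A rule: infinite_finite_induct) (auto simp: lpa_rep_zero lpa_rep_ops(1) free_algebra_sum)

lemma lpa_rep_relator: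
  assumes "p - q \<in> lpa_relators G" "q \<in> carrier (free_algebra (lpa_gens G))"
  shows "lpa_rep p = lpa_rep q"
proof -
  let ?F = "free_algebra (lpa_gens G) :: (('a, 'b) lpa_gen list \<Rightarrow>\<^sub>0 'c) ring"
  interpret ideal "lpa_ideal G" ?F by (rule lpa_ideal_ideal)
  have pq: "p - q \<in> carrier ?F" using assms(1) lpa_relators_in_free_algebra by blast
  have "p - q \<in> lpa_ideal G"
    using assms(1) genideal_self[OF lpa_relators_in_free_algebra] unfolding lpa_ideal_def by blast
  then have "lpa_coset (p - q) = lpa_coset 0"
    using a_coset_join2[OF _ a_subgroup] pq zero_closed additive_subgroup.zero_closed[OF is_additive_subgroup]
    by (simp add: lpa_coset_def free_algebra_simps)
  then have "lpa_rep (p - q) = 0" using lpa_rep_zero by (simp add: lpa_rep_def)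
  then show ?thesis using lpa_rep_ops(1)[OF pq assms(2)] by simp
qed

abbreviation lpa_scalar :: "'k::field \<Rightarrow> ('a, 'b) lpa_gen list \<Rightarrow>\<^sub>0 'k" where
  "lpa_scalar c \<equiv> Poly_Mapping.single [] c"

lemma lpa_gens_in_free_algebra:
  "v \<in> verts G \<Longrightarrow> vtx v \<in> carrier (free_algebra (lpa_gens G))"
  "e \<in> arcs G \<Longrightarrow> edge e \<in> carrier (free_algebra (lpa_gens G))"
  "e \<in> arcs G \<Longrightarrow> ghost e \<in> carrier (free_algebra (lpa_gens G))"
  "lpa_scalar c \<in> carrier (free_algebra (lpa_gens G))"
  by (auto intro!: free_algebra_single simp: lpa_gens_def)

lemma lpa_leavitt_family:
  "leavitt_family G (\<lambda>v. lpa_rep (vtx v :: ('a, 'b) lpa_gen list \<Rightarrow>\<^sub>0 'k::field))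
     (\<lambda>e. lpa_rep (edge e)) (\<lambda>e. lpa_rep (ghost e)) (\<lambda>c. lpa_rep (lpa_scalar c))"
proof (intro leavitt_family.intro leavitt_family_axioms.intro wf_digraph)
  note mem = lpa_gens_in_free_algebra free_algebra_closed
  fix v w :: 'a and e f :: 'b and c d :: 'k
  show "lpa_rep (vtx v) * lpa_rep (vtx w) = (if v = w then lpa_rep (vtx v) else (0 :: (('a, 'b) lpa_gen list \<Rightarrow>\<^sub>0 'k) set ring_product))"
    if "v \<in> verts G" "w \<in> verts G"
    using lpa_rep_relator[OF lpa_relators.vertex_vertex[OF that]] that lpa_rep_zero
    by (cases "v = w") (auto simp: lpa_rep_ops(2)[symmetric] mem)
  show "lpa_rep (vtx (tail G e)) * lpa_rep (edge e) = (lpa_rep (edge e) :: (('a, 'b) lpa_gen list \<Rightarrow>\<^sub>0 'k) set ring_product)"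
    if "e \<in> arcs G"
    using lpa_rep_relator[OF lpa_relators.source_edge[OF that]] that
    by (simp add: lpa_rep_ops(2)[symmetric] mem)
  show "lpa_rep (edge e) * lpa_rep (vtx (head G e)) = (lpa_rep (edge e) :: (('a, 'b) lpa_gen list \<Rightarrow>\<^sub>0 'k) set ring_product)"
    if "e \<in> arcs G"
    using lpa_rep_relator[OF lpa_relators.edge_range[OF that]] that
    by (simp add: lpa_rep_ops(2)[symmetric] mem)
  show "lpa_rep (vtx (head G e)) * lpa_rep (ghost e) = (lpa_rep (ghost e) :: (('a, 'b) lpa_gen list \<Rightarrow>\<^sub>0 'k) set ring_product)"
    if "e \<in> arcs G"
    using lpa_rep_relator[OF lpa_relators.range_ghost[OF that]] that
    by (simp add: lpa_rep_ops(2)[symmetric] mem)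
  show "lpa_rep (ghost e) * lpa_rep (vtx (tail G e)) = (lpa_rep (ghost e) :: (('a, 'b) lpa_gen list \<Rightarrow>\<^sub>0 'k) set ring_product)"
    if "e \<in> arcs G"
    using lpa_rep_relator[OF lpa_relators.ghost_source[OF that]] that
    by (simp add: lpa_rep_ops(2)[symmetric] mem)
  show "lpa_rep (ghost e) * lpa_rep (edge f) = (if e = f then lpa_rep (vtx (head G e)) else (0 :: (('a, 'b) lpa_gen list \<Rightarrow>\<^sub>0 'k) set ring_product))"
    if "e \<in> arcs G" "f \<in> arcs G"
    using lpa_rep_relator[OF lpa_relators.CK1[OF that]] that lpa_rep_zero
    by (cases "e = f") (auto simp: lpa_rep_ops(2)[symmetric] mem)
  show "lpa_rep (vtx v) = (\<Sum>e\<in>out_arcs G v. lpa_rep (edge e) * (lpa_rep (ghost e) :: (('a, 'b) lpa_gen list \<Rightarrow>\<^sub>0 'k) set ring_product))"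
    if "regular_vertex v"
  proof -
    have in_F: "edge e * ghost e \<in> carrier (free_algebra (lpa_gens G))" if "e \<in> out_arcs G v" for e
      using that by (intro mem) (auto simp: out_arcs_def)
    have "lpa_rep (vtx v) = lpa_rep (\<Sum>e\<in>out_arcs G v. edge e * (ghost e :: ('a, 'b) lpa_gen list \<Rightarrow>\<^sub>0 'k))"
      by (intro lpa_rep_relator lpa_relators.CK2 that free_algebra_sum in_F)
    also have "\<dots> = (\<Sum>e\<in>out_arcs G v. lpa_rep (edge e * ghost e))"
      by (intro lpa_rep_sum in_F)
    also have "\<dots> = (\<Sum>e\<in>out_arcs G v. lpa_rep (edge e) * lpa_rep (ghost e))"
      by (intro sum.cong) (auto simp: out_arcs_def mem intro!: lpa_rep_ops(2))
    finally show ?thesis .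
  qed
  show "lpa_rep (lpa_scalar (c + d)) = lpa_rep (lpa_scalar c) + lpa_rep (lpa_scalar d)"
    by (simp add: single_add lpa_rep_ops(1) mem)
  show "lpa_rep (lpa_scalar (c * d)) = lpa_rep (lpa_scalar c) * lpa_rep (lpa_scalar d)"
    by (simp add: lpa_rep_ops(2)[symmetric] mem mult_single plus_list_def)
  show "lpa_rep (lpa_scalar 1) * lpa_rep (vtx v) = (lpa_rep (vtx v) :: (('a, 'b) lpa_gen list \<Rightarrow>\<^sub>0 'k) set ring_product)"
    if "v \<in> verts G"
    using that by (simp add: lpa_rep_ops(2)[symmetric] mem mult_single plus_list_def)
  show "lpa_rep (vtx v) * lpa_rep (lpa_scalar c) = lpa_rep (lpa_scalar c) * lpa_rep (vtx v)" if "v \<in> verts G"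
    using that by (simp add: lpa_rep_ops(2)[symmetric] mem mult_single plus_list_def)
  show "lpa_rep (edge e) * lpa_rep (lpa_scalar c) = lpa_rep (lpa_scalar c) * lpa_rep (edge e)" if "e \<in> arcs G"
    using that by (simp add: lpa_rep_ops(2)[symmetric] mem mult_single plus_list_def)
  show "lpa_rep (ghost e) * lpa_rep (lpa_scalar c) = lpa_rep (lpa_scalar c) * lpa_rep (ghost e)" if "e \<in> arcs G"
    using that by (simp add: lpa_rep_ops(2)[symmetric] mem mult_single plus_list_def)
qed

lemma lpa_carrier:
  "carrier (lpa TYPE('k::field) G) = lpa_coset ` carrier (free_nonunital_algebra (lpa_gens G))"
  by (auto simp: lpa_def FactRing_def A_RCOSETS_def' lpa_coset_def a_r_coset_def' free_nonunital_algebra_def)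

text \<open>Coset operations depend on the underlying algebra only through its addition and
  multiplication, which the nonunital free algebra shares with the unital one.\<close>

lemma lpa_ops:
  "mult (lpa TYPE('k::field) G) = mult (unital_lpa TYPE('k))"
  "add (lpa TYPE('k) G) = add (unital_lpa TYPE('k))"
  "zero (lpa TYPE('k) G) = zero (unital_lpa TYPE('k))"
  by (auto simp: lpa_def unital_lpa_def FactRing_def free_nonunital_algebra_def rcoset_mult_def
      a_r_coset_def' set_add_def' fun_eq_iff)

lemma lpa_vertex_eq: "lpa_vertex TYPE('k::field) G v = lpa_coset (vtx v)"
  by (simp add: lpa_vertex_def lpa_coset_def a_r_coset_def' free_nonunital_algebra_def)

text \<open>The Leavitt path algebra is a subset of the unital quotient with the same operations, so
  the injection of the latter restricts to it.\<close>

lemma lpa_faithful: "faithful_ring (lpa TYPE('k::field) G) lpa_inject"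
proof -
  let ?F = "free_algebra (lpa_gens G) :: (('a, 'b) lpa_gen list \<Rightarrow>\<^sub>0 'k) ring"
  let ?A = "free_nonunital_algebra (lpa_gens G) :: (('a, 'b) lpa_gen list \<Rightarrow>\<^sub>0 'k) ring"
  interpret Q: faithful_ring "unital_lpa TYPE('k)" lpa_inject by (rule unital_lpa_faithful)
  interpret ideal "lpa_ideal G :: (('a, 'b) lpa_gen list \<Rightarrow>\<^sub>0 'k) set" ?F by (rule lpa_ideal_ideal)
  have F: "p \<in> carrier ?F" if "p \<in> carrier ?A" for p
    using that by (simp add: free_nonunital_algebra_mem)
  have zero: "\<zero>\<^bsub>unital_lpa TYPE('k)\<^esub> = lpa_coset 0"
    using a_coset_join2[OF _ a_subgroup, of 0] additive_subgroup.zero_closed[OF is_additive_subgroup]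
    by (simp add: unital_lpa_def FactRing_def lpa_coset_def free_algebra_simps free_algebra_closed)
  show ?thesis
  proof (rule faithful_ring.intro, unfold lpa_carrier lpa_ops)
    show "inj_on lpa_inject (lpa_coset ` carrier ?A)"
      using Q.inj by (rule inj_on_subset) (use lpa_coset_ops(1) F in blast)
    show "\<zero>\<^bsub>unital_lpa TYPE('k)\<^esub> \<in> lpa_coset ` carrier ?A"
      using zero free_nonunital_algebra_closed(1) by blast
    show "lpa_inject \<zero>\<^bsub>unital_lpa TYPE('k)\<^esub> = 0" by (rule Q.\<iota>_zero)
    fix x y :: "(('a, 'b) lpa_gen list \<Rightarrow>\<^sub>0 'k) set" assume x: "x \<in> lpa_coset ` carrier ?A"
    then obtain p where p: "x = lpa_coset p" "p \<in> carrier ?A" by blast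
    have "lpa_inject (lpa_coset (- p)) = - lpa_inject x"
      using lpa_rep_minus[OF F[OF p(2)]] by (simp add: p(1) lpa_rep_def)
    then show "\<exists>y\<in>lpa_coset ` carrier ?A. lpa_inject y = - lpa_inject x"
      using free_nonunital_algebra_closed(2)[OF p(2)] by blast
    assume "y \<in> lpa_coset ` carrier ?A"
    then obtain q where q: "y = lpa_coset q" "q \<in> carrier ?A" by blast
    note pq = lpa_coset_ops[OF F[OF p(2)] F[OF q(2)]] and qp = lpa_coset_ops(1)[OF F[OF q(2)] F[OF q(2)]]
    show "x \<oplus>\<^bsub>unital_lpa TYPE('k)\<^esub> y \<in> lpa_coset ` carrier ?A"
      using pq(2) free_nonunital_algebra_closed(3)[OF p(2) q(2)] by (simp add: p(1) q(1))
    show "x \<otimes>\<^bsub>unital_lpa TYPE('k)\<^esub> y \<in> lpa_coset ` carrier ?A"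
      using pq(3) free_nonunital_algebra_closed(4)[OF F[OF p(2)] q(2)] by (simp add: p(1) q(1))
    show "lpa_inject (x \<oplus>\<^bsub>unital_lpa TYPE('k)\<^esub> y) = lpa_inject x + lpa_inject y"
      using Q.\<iota>_add pq(1) qp by (simp add: p(1) q(1))
    show "lpa_inject (x \<otimes>\<^bsub>unital_lpa TYPE('k)\<^esub> y) = lpa_inject x * lpa_inject y"
      using Q.\<iota>_mult pq(1) qp by (simp add: p(1) q(1))
  qed
qed

text \<open>The main point is that the image is exactly the span of monomials: nonempty words are
  products of generators, and each monomial is a scalar times a product of real and ghost paths that
  come from nonempty words.\<close>

lemma lpa_leavitt_ring:
  "leavitt_ring G (\<lambda>v. lpa_rep (vtx v :: ('a, 'b) lpa_gen list \<Rightarrow>\<^sub>0 'k::field))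
     (\<lambda>e. lpa_rep (edge e)) (\<lambda>e. lpa_rep (ghost e)) (\<lambda>c. lpa_rep (lpa_scalar c))
     (lpa TYPE('k) G) lpa_inject (lpa_vertex TYPE('k) G)"
proof (intro leavitt_ring.intro leavitt_ring_axioms.intro lpa_leavitt_family lpa_faithful)
  let ?F = "free_algebra (lpa_gens G) :: (('a, 'b) lpa_gen list \<Rightarrow>\<^sub>0 'k) ring"
  let ?A = "free_nonunital_algebra (lpa_gens G) :: (('a, 'b) lpa_gen list \<Rightarrow>\<^sub>0 'k) ring"
  interpret leavitt_family G "\<lambda>v. lpa_rep (vtx v :: ('a, 'b) lpa_gen list \<Rightarrow>\<^sub>0 'k)"
    "\<lambda>e. lpa_rep (edge e)" "\<lambda>e. lpa_rep (ghost e)" "\<lambda>c. lpa_rep (lpa_scalar c)"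
    by (rule lpa_leavitt_family)
  note mem = lpa_gens_in_free_algebra free_algebra_closed
  have F: "p \<in> carrier ?F" if "p \<in> carrier ?A" for p
    using that by (simp add: free_nonunital_algebra_mem)
  have F0_gens: "vtx v \<in> carrier ?A" if "v \<in> verts G" for v
    using that by (simp add: free_nonunital_algebra_mem mem)
  have vertex: "lpa_vertex TYPE('k) G v = lpa_coset (vtx v)" for v by (rule lpa_vertex_eq)
  show "lpa_vertex TYPE('k) G v \<in> carrier (lpa TYPE('k) G)" if "v \<in> verts G" for v
    unfolding vertex lpa_carrier using F0_gens[OF that] by blast
  show "lpa_inject (lpa_vertex TYPE('k) G v) = lpa_rep (vtx v)" if "v \<in> verts G" for v
    by (simp add: vertex lpa_rep_def)
  \<comment> \<open>Nonemptiness matters: the empty word represents a scalar. The coefficient is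
    attached to a single generator.\<close>
  have word: "lpa_rep (Poly_Mapping.single w c) \<in> leavitt_span" if "w \<noteq> []" "set w \<subseteq> lpa_gens G" for w and c :: 'k
    using that
  proof (induction w arbitrary: c)
    case (Cons g w)
    have g: "lpa_rep (Poly_Mapping.single [g] c) \<in> leavitt_span" for c
    proof -
      have "Poly_Mapping.single [g] c = lpa_scalar c * Poly_Mapping.single [g] 1"
        by (simp add: mult_single plus_list_def)
      then have eq: "lpa_rep (Poly_Mapping.single [g] c)
          = lpa_rep (lpa_scalar c) * lpa_rep (Poly_Mapping.single [g] 1)"
        using Cons.prems by (simp add: lpa_rep_ops(2) mem free_algebra_single)
      from Cons.prems consider v where "g = Vertex v" "v \<in> verts G"
        | e where "g = Edge e" "e \<in> arcs G" | e where "g = Ghost e" "e \<in> arcs G"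
        by (auto simp: lpa_gens_def)
      then show ?thesis
      proof cases
        case 1
        then show ?thesis unfolding eq using rp_in_span(1)[of v "[]" v c] by (simp add: awalk_Nil_iff)
      next
        case 2
        then show ?thesis unfolding eq
          using rp_in_span(1)[of "tail G e" "[e]" "head G e" c] by (simp add: awalk_simps ed_head)
      next
        case 3
        then show ?thesis unfolding eq
          using gp_in_span(1)[of "tail G e" "[e]" "head G e" c] by (simp add: awalk_simps head_gh)
      qed
    qed
    show ?case
    proof (cases "w = []")
      case False
      have "Poly_Mapping.single (g # w) c = Poly_Mapping.single [g] 1 * Poly_Mapping.single w c"
        by (simp add: mult_single plus_list_def)
      then have "lpa_rep (Poly_Mapping.single (g # w) c)
          = lpa_rep (Poly_Mapping.single [g] 1) * lpa_rep (Poly_Mapping.single w c)"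
        using Cons.prems by (simp add: lpa_rep_ops(2) free_algebra_single)
      then show ?thesis using span_mult g Cons.IH[OF False] Cons.prems by simp
    qed (use g in simp)
  qed simp
  have sub: "lpa_rep p \<in> leavitt_span" if "p \<in> carrier ?A" for p
  proof -
    have w: "w \<noteq> []" "set w \<subseteq> lpa_gens G" if "w \<in> Poly_Mapping.keys p" for w
      using that \<open>p \<in> carrier ?A\<close> by (auto simp: free_nonunital_algebra_mem free_algebra_mem)
    have "lpa_rep (\<Sum>w\<in>Poly_Mapping.keys p. Poly_Mapping.single w (Poly_Mapping.lookup p w))
        = (\<Sum>w\<in>Poly_Mapping.keys p. lpa_rep (Poly_Mapping.single w (Poly_Mapping.lookup p w)))"
      by (intro lpa_rep_sum free_algebra_single w)
    then have "lpa_rep p = (\<Sum>w\<in>Poly_Mapping.keys p. lpa_rep (Poly_Mapping.single w (Poly_Mapping.lookup p w)))"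
      by (simp only: poly_mapping_sum_single)
    also have "\<dots> \<in> leavitt_span" by (intro span_sum word w)
    finally show ?thesis .
  qed
  have rp: "\<exists>a\<in>carrier ?A. lpa_rep a = rp p u" if "awalk w p u" for w p u
    using that
  proof (induction p arbitrary: w)
    case Nil
    then show ?case using F0_gens by (auto simp: awalk_Nil_iff)
  next
    case (Cons e p)
    then obtain a where a: "a \<in> carrier ?A" "lpa_rep a = rp p u" and e: "e \<in> arcs G"
      by (auto simp: awalk_Cons_iff)
    have "lpa_rep (edge e * a) = rp (e # p) u"
      using lpa_rep_ops(2)[OF mem(2)[OF e] F[OF a(1)]] a(2) by simp
    then show ?case
      using free_nonunital_algebra_closed(4)[OF mem(2)[OF e] a(1)] by blast
  qed
  have gp: "\<exists>a\<in>carrier ?A. lpa_rep a = gp p u" if "awalk w p u" for w p u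
    using that
  proof (induction p arbitrary: w)
    case Nil
    then show ?case using F0_gens by (auto simp: awalk_Nil_iff)
  next
    case (Cons e p)
    then obtain a where a: "a \<in> carrier ?A" "lpa_rep a = gp p u" and e: "e \<in> arcs G"
      by (auto simp: awalk_Cons_iff)
    have "ghost e \<in> carrier ?A"
      using e by (simp add: free_nonunital_algebra_mem mem)
    moreover have "lpa_rep (a * ghost e) = gp (e # p) u"
      using lpa_rep_ops(2)[OF F[OF a(1)] mem(3)[OF e]] a(2) by simp
    ultimately show ?case
      using free_nonunital_algebra_closed(4)[OF F[OF a(1)]] by blast
  qed
  \<comment> \<open>Multiplying by the constant polynomial stays within the nonunital free algebra,
    since its right factor has no constant term.\<close>
  have sup: "\<exists>a\<in>carrier ?A. lpa_rep a = z" if "z \<in> leavitt_span" for z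
    using that unfolding leavitt_span_def
  proof induction
    case zero
    then show ?case using free_nonunital_algebra_closed(1) lpa_rep_zero by blast
  next
    case (add b z)
    then obtain c p q u v w where b: "awalk v p u" "awalk w q u" "b = lpa_rep (lpa_scalar c) * (rp p u * gp q u)"
      unfolding monomials_def by blast
    obtain x y where "x \<in> carrier ?A" "lpa_rep x = rp p u" "y \<in> carrier ?A" "lpa_rep y = gp q u"
      using rp[OF b(1)] gp[OF b(2)] by blast
    moreover from this have "lpa_scalar c * (x * y) \<in> carrier ?A"
      by (intro free_nonunital_algebra_closed mem F)
    moreover obtain a where "a \<in> carrier ?A" "lpa_rep a = z" using add.IH by blast
    ultimately show ?case using b(3)
      by (intro bexI[of _ "lpa_scalar c * (x * y) + a"])
        (auto simp: lpa_rep_ops mem F free_nonunital_algebra_closed)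
  qed
  show "lpa_inject ` carrier (lpa TYPE('k) G) = leavitt_span"
    unfolding lpa_carrier image_image lpa_rep_def[symmetric] using sub sup by blast
qed

end

theorem theorem4p4:
  fixes E :: "('v, 'e) pre_digraph"
  assumes "wf_digraph E"
  shows "purely_infinite_ideal
           (nonunital_genideal (lpa TYPE('k::field) E)
              (lpa_vertex TYPE('k) E ` pre_digraph.P_ec E))
           (lpa TYPE('k) E)"
  using leavitt_ring.recurrent_vertices_purely_infinite[OF wf_digraph.lpa_leavitt_ring[OF assms]
      wf_digraph.P_ec_recurrent[OF assms]] .

end
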